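(* Let $m=2k+1\ge5$ be an odd integer, let $G=\langle s,t\mid \Pi(s,t,m)=\Pi(t,s,m)\rangle$ be the Artin group of type $I_2(m)$, let $M$ be the submonoid of $G$ generated by $\{s,t\}$, let $\Omega=\Pi(s,t,m)=(st)^ks=(ts)^kt$ and $\Delta=\Omega^2$. Let $G_1$ (resp. $M_1$) be the subgroup (resp. submonoid) generated by $t$, with $\Delta_1=t^2$, and let $H$ (resp. $N$) be the subgroup (resp. submonoid) generated by $s$, with $\Lambda=s^2$. Then, with respect to the Garside structure $(G,M,\Delta)$, the pair $(H,G_1)$ is a Dehornoy structure on $G$.
   Context: $\Pi(s,t,m)$ denotes the alternating word $sts\cdots$ of length $m$. For $\alpha,\beta\in G$: $\alpha\le_R\beta$ iff $\beta\alpha^{-1}\in M$. It is known that $(G,M,\Delta)$ is a Garside structure with $\Delta$ central in $G$, and that $(G_1,M_1,\Delta_1)$ and $(H,N,\Lambda)$ are parabolic substructures of it. An element $a\in M$ is unmovable if $\Delta\not\le_R a$. Every $\alpha\in G$ is uniquely $\alpha=a\Delta^j$ with $a\in M$ unmovable and $j\in\mathbb Z$ (the $\Delta$-form of $\alpha$). Depth. For $K\in\{M_1,N\}$ and $a\in M$, $\tau_K(a)$ denotes the unique $b\in K$ with $\{c\in K\mid c\le_R a\}=\{c\in K\mid c\le_R b\}$. Every $a\in M\setminus\{1\}$ is uniquely $a=a_p\cdots a_2a_1$ with $a_p\ne1$, $a_i=\tau_{M_1}(a_p\cdots a_i)$ for $i$ odd and $a_i=\tau_N(a_p\cdots a_i)$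 for $i$ even; set $\mathrm{bh}(a)=p$ and $\mathrm{bh}(1)=1$. The depth is $\mathrm{dpt}(a)=(\mathrm{bh}(a)-1)/2$ if $\mathrm{bh}(a)$ is odd and $\mathrm{bh}(a)/2$ if $\mathrm{bh}(a)$ is even. Dehornoy structure. An element $\alpha\in G$ with $\Delta$-form $\alpha=a\Delta^{-j}$ is $(H,G_1)$-negative if $j\ge1$ and $\mathrm{dpt}(a)<\mathrm{dpt}(\Delta^j)$; $\alpha$ is $(H,G_1)$-positive if $\alpha^{-1}$ is $(H,G_1)$-negative. Let $P$ be the set of $(H,G_1)$-positive elements; $P^{-1}$ is then the set of $(H,G_1)$-negative elements. The pair $(H,G_1)$ is a Dehornoy structure if (a) $PP\subset P$, (b) $G_1PG_1\subset P$, (c) $G=P\sqcup P^{-1}\sqcup G_1$ (disjoint union). *)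

theory Defs
  imports "HOL-Algebra.Coset" "HOL-Algebra.Generated_Groups"
begin

section \<open>Groups given by generators and relations\<close>

text \<open>
  A letter \<open>(x, True)\<close> stands for the generator \<open>x\<close> and \<open>(x, False)\<close> for its
  formal inverse.  All elements of the type \<open>'a\<close> are generators.
\<close>

type_synonym 'a gword = "('a \<times> bool) list"

inductive pres_cong :: "('a gword \<times> 'a gword) set \<Rightarrow> 'a gword \<Rightarrow> 'a gword \<Rightarrow> bool"
  for R where
  refl: "pres_cong R u u"
| sym: "pres_cong R u v \<Longrightarrow> pres_cong R v u"
| trans: "pres_cong R u v \<Longrightarrow> pres_cong R v w \<Longrightarrow> pres_cong R u w"
| append: "pres_cong R u u' \<Longrightarrow> pres_cong R v v' \<Longrightarrow> pres_cong R (u @ v) (u' @ v')"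
| cancel: "pres_cong R [(x, b), (x, \<not> b)] []"
| relator: "(u, v) \<in> R \<Longrightarrow> pres_cong R u v"

definition pres_class :: "('a gword \<times> 'a gword) set \<Rightarrow> 'a gword \<Rightarrow> 'a gword set" where
  "pres_class R u = {v. pres_cong R u v}"

definition presented_group :: "('a gword \<times> 'a gword) set \<Rightarrow> 'a gword set monoid" where
  "presented_group R =
     \<lparr>carrier = range (pres_class R),
      mult = (\<lambda>A B. {w. \<exists>u\<in>A. \<exists>v\<in>B. pres_cong R (u @ v) w}),
      one = pres_class R []\<rparr>"

definition positive_word :: "'a list \<Rightarrow> 'a gword" where
  "positive_word xs = map (\<lambda>x. (x, True)) xs"

lemma pres_class_eq_iff: "pres_class R u = pres_class R v \<longleftrightarrow> pres_cong R u v"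
  unfolding pres_class_def
  by (auto intro: pres_cong.refl pres_cong.sym pres_cong.trans dest: equalityD1)

lemma presented_group_mult:
  "pres_class R u \<otimes>\<^bsub>presented_group R\<^esub> pres_class R v = pres_class R (u @ v)"
  unfolding presented_group_def pres_class_def
  by (auto intro: pres_cong.refl pres_cong.trans pres_cong.append)

lemma presented_group_carrier: "carrier (presented_group R) = range (pres_class R)"
  by (simp add: presented_group_def)

lemma presented_group_one: "\<one>\<^bsub>presented_group R\<^esub> = pres_class R []"
  by (simp add: presented_group_def)

lemma pres_cong_formal_inverse:
  "pres_cong R (rev (map (\<lambda>(x, b). (x, \<not> b)) u) @ u) []"
proof (induction u)
  case Nil
  then show ?case by (simp add: pres_cong.refl)
next
  case (Cons a u)
  obtain x b where a: "a = (x, b)" by (cases a)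
  let ?v = "rev (map (\<lambda>(x, b). (x, \<not> b)) u)"
  have "pres_cong R [(x, \<not> b), (x, b)] []"
    using pres_cong.cancel[of R x "\<not> b"] by simp
  note 1 = pres_cong.append[OF this pres_cong.refl[of R u]]
  have "pres_cong R (?v @ ([(x, \<not> b), (x, b)] @ u)) (?v @ ([] @ u))"
    by (rule pres_cong.append[OF pres_cong.refl 1])
  then show ?case
    using Cons.IH by (auto simp: a intro: pres_cong.trans)
qed

lemma group_presented_group: "group (presented_group R)"
proof (rule groupI)
  fix x assume "x \<in> carrier (presented_group R)"
  then obtain u where u: "x = pres_class R u" by (auto simp: presented_group_carrier)
  show "\<exists>y\<in>carrier (presented_group R). y \<otimes>\<^bsub>presented_group R\<^esub> x = \<one>\<^bsub>presented_group R\<^esub>"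
    by (rule bexI[of _ "pres_class R (rev (map (\<lambda>(x, b). (x, \<not> b)) u))"])
       (auto simp: u presented_group_mult presented_group_carrier presented_group_one
          pres_class_eq_iff pres_cong_formal_inverse)
qed (auto simp: presented_group_mult presented_group_carrier presented_group_one)


section \<open>The Artin groups of type \<open>I\<^sub>2(m)\<close>\<close>

text \<open>The alternating word \<open>\<Pi>(a,b,n) = aba\<cdots>\<close> of length \<open>n\<close>.\<close>

fun alt_word :: "'a \<Rightarrow> 'a \<Rightarrow> nat \<Rightarrow> 'a list" where
  "alt_word a b 0 = []"
| "alt_word a b (Suc n) = a # alt_word b a n"

datatype artin_gen = S_gen | T_gen

definition artin_I2_rels :: "nat \<Rightarrow> (artin_gen gword \<times> artin_gen gword) set" where
  "artin_I2_rels m =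
     {(positive_word (alt_word S_gen T_gen m), positive_word (alt_word T_gen S_gen m))}"

definition artin_I2 :: "nat \<Rightarrow> artin_gen gword set monoid" where
  "artin_I2 m = presented_group (artin_I2_rels m)"

definition artin_s :: "nat \<Rightarrow> artin_gen gword set" where
  "artin_s m = pres_class (artin_I2_rels m) (positive_word [S_gen])"

definition artin_t :: "nat \<Rightarrow> artin_gen gword set" where
  "artin_t m = pres_class (artin_I2_rels m) (positive_word [T_gen])"


section \<open>Submonoids and products of lists\<close>

definition submonoid_generate :: "('a, 'b) monoid_scheme \<Rightarrow> 'a set \<Rightarrow> 'a set" where
  "submonoid_generate G A = \<Inter>{K. submonoid K G \<and> A \<subseteq> K}"

definition list_prod :: "('a, 'b) monoid_scheme \<Rightarrow> 'a list \<Rightarrow> 'a" where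
  "list_prod G xs = foldr (mult G) xs \<one>\<^bsub>G\<^esub>"


section \<open>Depth and Dehornoy structures\<close>

text \<open>
  The definitions below are meant for a Garside structure \<open>(G, M, \<Delta>)\<close> with \<open>\<Delta>\<close> central and
  parabolic substructures with underlying groups \<open>H\<close>, \<open>G\<^sub>1\<close> and underlying monoids
  \<open>N\<close>, \<open>M\<^sub>1\<close>.  The existence and uniqueness facts that justify the two
  uses of \<open>THE\<close> hold in that situation.
\<close>

definition le_R :: "('a, 'b) monoid_scheme \<Rightarrow> 'a set \<Rightarrow> 'a \<Rightarrow> 'a \<Rightarrow> bool" where
  "le_R G M \<alpha> \<beta> \<longleftrightarrow> \<beta> \<otimes>\<^bsub>G\<^esub> inv\<^bsub>G\<^esub> \<alpha> \<in> M"

definition unmovable :: "('a, 'b) monoid_scheme \<Rightarrow> 'a set \<Rightarrow> 'a \<Rightarrow> 'a \<Rightarrow> bool" where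
  "unmovable G M \<Delta> a \<longleftrightarrow> a \<in> M \<and> \<not> le_R G M \<Delta> a"

definition is_delta_form ::
  "('a, 'b) monoid_scheme \<Rightarrow> 'a set \<Rightarrow> 'a \<Rightarrow> 'a \<Rightarrow> 'a \<Rightarrow> int \<Rightarrow> bool" where
  "is_delta_form G M \<Delta> \<alpha> a j \<longleftrightarrow>
     unmovable G M \<Delta> a \<and> \<alpha> = a \<otimes>\<^bsub>G\<^esub> (\<Delta> [^]\<^bsub>G\<^esub> j)"

definition tail :: "('a, 'b) monoid_scheme \<Rightarrow> 'a set \<Rightarrow> 'a set \<Rightarrow> 'a \<Rightarrow> 'a" where
  "tail G M K a =
     (THE b. b \<in> K \<and> {c \<in> K. le_R G M c a} = {c \<in> K. le_R G M c b})"

text \<open>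
  The list \<open>as\<close> is \<open>[a\<^sub>p, \<dots>, a\<^sub>2, a\<^sub>1]\<close>, in the order in which the product is written;
  thus \<open>a\<^sub>i\<close> is \<open>as ! (p - i)\<close> and \<open>a\<^sub>p \<cdots> a\<^sub>i\<close> is the product of the first
  \<open>p - i + 1\<close> entries.
\<close>

definition is_alternating_form ::
  "('a, 'b) monoid_scheme \<Rightarrow> 'a set \<Rightarrow> 'a set \<Rightarrow> 'a set \<Rightarrow> 'a \<Rightarrow> 'a list \<Rightarrow> bool" where
  "is_alternating_form G M M1 N a as \<longleftrightarrow>
     set as \<subseteq> M \<and> as \<noteq> [] \<and> hd as \<noteq> \<one>\<^bsub>G\<^esub> \<and> list_prod G as = a \<and>
     (\<forall>i\<in>{1..length as}.
        as ! (length as - i) =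
        tail G M (if odd i then M1 else N) (list_prod G (take (length as - i + 1) as)))"

definition breadth ::
  "('a, 'b) monoid_scheme \<Rightarrow> 'a set \<Rightarrow> 'a set \<Rightarrow> 'a set \<Rightarrow> 'a \<Rightarrow> nat" where
  "breadth G M M1 N a =
     (if a = \<one>\<^bsub>G\<^esub> then 1
      else (THE p. \<exists>as. is_alternating_form G M M1 N a as \<and> length as = p))"

definition depth ::
  "('a, 'b) monoid_scheme \<Rightarrow> 'a set \<Rightarrow> 'a set \<Rightarrow> 'a set \<Rightarrow> 'a \<Rightarrow> nat" where
  "depth G M M1 N a =
     (if odd (breadth G M M1 N a) then (breadth G M M1 N a - 1) div 2
      else breadth G M M1 N a div 2)"

definition dehornoy_negative ::
  "('a, 'b) monoid_scheme \<Rightarrow> 'a set \<Rightarrow> 'a \<Rightarrow> 'a set \<Rightarrow> 'a set \<Rightarrow> 'a \<Rightarrow> bool" where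
  "dehornoy_negative G M \<Delta> N M1 \<alpha> \<longleftrightarrow>
     (\<exists>a j::int. is_delta_form G M \<Delta> \<alpha> a (- j) \<and> j \<ge> 1 \<and>
        depth G M M1 N a < depth G M M1 N (\<Delta> [^]\<^bsub>G\<^esub> j))"

definition positive_elements ::
  "('a, 'b) monoid_scheme \<Rightarrow> 'a set \<Rightarrow> 'a \<Rightarrow> 'a set \<Rightarrow> 'a set \<Rightarrow> 'a set" where
  "positive_elements G M \<Delta> N M1 =
     {\<alpha> \<in> carrier G. dehornoy_negative G M \<Delta> N M1 (inv\<^bsub>G\<^esub> \<alpha>)}"

text \<open>
  The substructures are passed as pairs \<open>(H, N)\<close> and \<open>(G\<^sub>1, M\<^sub>1)\<close> of a group and its monoid.
  The group \<open>H\<close> enters the conditions only through its monoid \<open>N\<close>.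
\<close>

definition dehornoy_structure ::
  "('a, 'b) monoid_scheme \<Rightarrow> 'a set \<Rightarrow> 'a \<Rightarrow> 'a set \<times> 'a set \<Rightarrow> 'a set \<times> 'a set \<Rightarrow> bool" where
  "dehornoy_structure G M \<Delta> = (\<lambda>(H, N) (G1, M1).
     let P = positive_elements G M \<Delta> N M1 in
       P <#>\<^bsub>G\<^esub> P \<subseteq> P \<and>
       G1 <#>\<^bsub>G\<^esub> P <#>\<^bsub>G\<^esub> G1 \<subseteq> P \<and>
       carrier G = P \<union> set_inv\<^bsub>G\<^esub> P \<union> G1 \<and>
       P \<inter> set_inv\<^bsub>G\<^esub> P = {} \<and> P \<inter> G1 = {} \<and> set_inv\<^bsub>G\<^esub> P \<inter> G1 = {})"


section \<open>Basic facts on \<open>I\<^sub>2(m)\<close>\<close>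

lemma group_artin_I2: "group (artin_I2 m)"
  by (simp add: artin_I2_def group_presented_group)

lemma artin_s_carrier: "artin_s m \<in> carrier (artin_I2 m)"
  and artin_t_carrier: "artin_t m \<in> carrier (artin_I2 m)"
  by (auto simp: artin_s_def artin_t_def artin_I2_def presented_group_carrier)

lemma (in group) list_prod_alt_word_odd:
  assumes "a \<in> carrier G" "b \<in> carrier G"
  shows "list_prod G (alt_word a b (2 * k + 1)) = (a \<otimes> b) [^] k \<otimes> a"
proof (induction k)
  case 0
  then show ?case using assms by (simp add: list_prod_def)
next
  case (Suc k)
  have "list_prod G (alt_word a b (2 * Suc k + 1)) =
        a \<otimes> (b \<otimes> list_prod G (alt_word a b (2 * k + 1)))"
    by (simp add: list_prod_def)
  also have "\<dots> = (a \<otimes> b) \<otimes> (a \<otimes> b) [^] k \<otimes> a"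
    using assms unfolding Suc.IH by (simp add: m_assoc)
  also have "(a \<otimes> b) \<otimes> (a \<otimes> b) [^] k = (a \<otimes> b) [^] Suc k"
    using assms by (metis m_closed nat_pow_Suc2)
  finally show ?case .
qed

lemma artin_I2_relation:
  "list_prod (artin_I2 m) (alt_word (artin_s m) (artin_t m) m) =
   list_prod (artin_I2 m) (alt_word (artin_t m) (artin_s m) m)"
proof -
  let ?g = "\<lambda>x. pres_class (artin_I2_rels m) (positive_word [x])"
  have *: "list_prod (artin_I2 m) (map ?g xs) = pres_class (artin_I2_rels m) (positive_word xs)" for xs
    by (induction xs)
       (auto simp: list_prod_def artin_I2_def presented_group_one presented_group_mult positive_word_def)
  have m: "alt_word (?g x) (?g y) n = map ?g (alt_word x y n)" for x y n
    by (induction n arbitrary: x y) auto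
  have "pres_cong (artin_I2_rels m) (positive_word (alt_word S_gen T_gen m))
          (positive_word (alt_word T_gen S_gen m))"
    by (rule pres_cong.relator) (simp add: artin_I2_rels_def)
  then show ?thesis
    by (simp add: artin_s_def artin_t_def m * pres_class_eq_iff)
qed

end

theory Submission
  imports Complex_Main Defs "HOL-Algebra.Elementary_Groups" "HOL-Algebra.Bij"
begin

text \<open>
  Put \<open>x = st\<close>, so that \<open>\<Delta> = x\<^sup>m\<close> is central.  The group \<open>G\<close> acts on the real line by increasing
  bijections: \<open>x\<close> is the translation by \<open>m - 2\<close>, and \<open>s\<close> and \<open>t\<close> are piecewise linear maps with
  fixed points \<open>m\<int> - 1\<close> and \<open>m\<int>\<close> respectively.  The stabiliser of \<open>0\<close> is exactly \<open>\<langle>t\<rangle>\<close>, so it is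
  enough to show that \<open>\<alpha>\<close> is negative if and only if \<open>\<alpha> \<cdot> 0 < 0\<close>.

  This holds because the depth of \<open>a \<in> M\<close> reads off the position of \<open>a \<cdot> 0\<close>: if the depth is
  \<open>d \<ge> 1\<close>, then \<open>(d - 1)m \<le> a \<cdot> 0 < dm\<close>, and if it is \<open>0\<close>, then \<open>a \<cdot> 0 = 0\<close>.  As
  \<open>\<Delta>\<^sup>j \<cdot> 0 = j(m - 2)m\<close>, the condition \<open>dpt(a) < dpt(\<Delta>\<^sup>j)\<close> says that \<open>a \<cdot> 0 < \<Delta>\<^sup>j \<cdot> 0\<close>.
  For the bounds, strip the maximal power of \<open>t\<close> from the right of \<open>a\<close>.  Since \<open>\<Omega>\<close> is right divisible by
  \<open>t\<close> and permutes the generators, no word for the rest contains \<open>\<Omega>\<close>; reading such a word from right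
  to left, each block of letters \<open>s\<close> or \<open>t\<close> moves the image of \<open>0\<close> into the next interval cut out by
  the fixed points of \<open>s\<close> and \<open>t\<close>.
\<close>

section \<open>A piecewise linear map of the line\<close>

text \<open>
  Slope \<open>m - 1\<close> on \<open>[nm - 1, nm]\<close> and slope \<open>1 / (m - 1)\<close> on \<open>[nm, nm + m - 1]\<close>.  The two slopes
  are inverse to each other, which gives \<open>shear_shift_shear\<close> and hence that \<open>st\<close> acts as a translation.
\<close>

definition shear :: "real \<Rightarrow> real \<Rightarrow> real" where
  "shear m z = (let n = of_int \<lfloor>(z + 1) / m\<rfloor>; u = z - n * m in
     if u \<le> 0 then n * m + (m - 1) * (u + 1) - 1 else n * m + m - 2 + u / (m - 1))"

lemma shear_left:
  assumes "m > 2" "-1 \<le> u" "u \<le> 0"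
  shows "shear m (of_int n * m + u) = of_int n * m + (m - 1) * (u + 1) - 1"
proof -
  have "\<lfloor>(of_int n * m + u + 1) / m\<rfloor> = n"
    using assms by (intro floor_unique) (auto simp: field_simps)
  then show ?thesis
    using assms by (simp add: shear_def Let_def)
qed

lemma shear_right:
  assumes "m > 2" "0 \<le> u" "u \<le> m - 1"
  shows "shear m (of_int n * m + u) = of_int n * m + m - 2 + u / (m - 1)"
proof (cases "u = m - 1")
  case True
  \<comment> \<open>At \<open>u = m - 1\<close> the floor has already jumped to
    \<open>n + 1\<close>; the two linear formulas agree at this break point.\<close>
  have "shear m (of_int (n + 1) * m + (-1)) = of_int (n + 1) * m - 1"
    using shear_left[of m "-1" "n + 1"] assms by simp
  moreover have "of_int (n + 1) * m + (-1) = of_int n * m + u"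
    by (simp add: True algebra_simps)
  moreover have "u / (m - 1) = 1"
    using True assms by simp
  ultimately show ?thesis
    by (simp add: algebra_simps)
next
  case False
  have "\<lfloor>(of_int n * m + u + 1) / m\<rfloor> = n"
    using assms False by (intro floor_unique) (auto simp: field_simps)
  then show ?thesis
    using assms by (auto simp: shear_def Let_def)
qed

lemma shear_cases:
  fixes m z :: real
  assumes "m > 2"
  obtains n u where "z = of_int n * m + u" "-1 \<le> u" "u \<le> 0"
  | n u where "z = of_int n * m + u" "0 \<le> u" "u < m - 1"
proof -
  define n where "n = \<lfloor>(z + 1) / m\<rfloor>"
  define u where "u = z - of_int n * m"
  have "of_int n \<le> (z + 1) / m" "(z + 1) / m < of_int n + 1"
    unfolding n_def by linarith+
  then have "-1 \<le> u" "u < m - 1"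
    using assms by (auto simp: u_def field_simps)
  then show ?thesis
    using that(1)[of n u] that(2)[of n u] by (cases "u \<le> 0") (auto simp: u_def)
qed

lemma shear_add_period:
  assumes "m > 2"
  shows "shear m (z + of_int j * m) = shear m z + of_int j * m"
proof (cases rule: shear_cases[OF assms, of z])
  case (1 n u)
  then show ?thesis
    using shear_left[of m u n] shear_left[of m u "n + j"] assms by (simp add: algebra_simps)
next
  case (2 n u)
  then show ?thesis
    using shear_right[of m u n] shear_right[of m u "n + j"] assms by (simp add: algebra_simps)
qed

text \<open>Followed by the shift by 1, the map takes \<open>[n m - 1, n m]\<close> onto
  \<open>[n m, n m + m - 1]\<close>, and that interval onto
  \<open>[(n + 1) m - 1, (n + 1) m]\<close>. Two steps thus meet both slopes, whose product is
  1.\<close>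

lemma shear_shift_shear:
  assumes "m > 2"
  shows "shear m (shear m z + 1) = z + m - 1"
proof (cases rule: shear_cases[OF assms, of z])
  case (1 n u)
  have "(m - 1) * (u + 1) \<le> m - 1"
    using 1 assms by (simp add: mult_left_le)
  then show ?thesis
    using shear_left[of m u n] shear_right[of m "(m - 1) * (u + 1)" n] 1 assms by simp
next
  case (2 n u)
  have "shear m (of_int (n + 1) * m + (u / (m - 1) - 1)) = of_int (n + 1) * m + u - 1"
    using shear_left[of m "u / (m - 1) - 1" "n + 1"] 2 assms by (auto simp: divide_simps)
  moreover have "shear m z + 1 = of_int (n + 1) * m + (u / (m - 1) - 1)"
    using shear_right[of m u n] 2 assms by (simp add: algebra_simps)
  ultimately have "shear m (shear m z + 1) = of_int (n + 1) * m + u - 1"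
    by (simp only:)
  then show ?thesis
    using 2 by (simp add: algebra_simps)
qed

lemma strict_mono_shear:
  assumes "m > 2"
  shows "strict_mono (shear m)"
proof -
  \<comment> \<open>The windows \<open>[n m - 1, n m + m - 1)\<close> tile the line and each is
    mapped into its closure, so the formulas need comparing only inside one window.\<close>
  have window: "\<exists>n u. w = of_int n * m + u \<and> -1 \<le> u \<and> u < m - 1 \<and>
      of_int n * m - 1 \<le> shear m w \<and> shear m w \<le> of_int n * m + m - 1 \<and>
      shear m w = of_int n * m + (if u \<le> 0 then (m - 1) * (u + 1) - 1 else m - 2 + u / (m - 1))" for w
  proof (cases rule: shear_cases[OF assms, of w])
    case (1 n u)
    have "(m - 1) * (u + 1) \<le> m - 1"
      using 1 assms by (simp add: mult_left_le)
    moreover have "0 \<le> (m - 1) * (u + 1)"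
      using 1 assms by simp
    ultimately have "(m - 1) * (u + 1) - 1 \<le> m - 1" "-1 \<le> (m - 1) * (u + 1) - 1"
      by linarith+
    then show ?thesis
      using 1 assms shear_left[of m u n]
      by (intro exI[of _ n] exI[of _ u] conjI) simp_all
  next
    case (2 n u)
    have "u / (m - 1) \<le> 1" "1 \<le> m + u / (m - 1)"
      using 2 assms by (simp_all add: add_increasing2)
    then show ?thesis
      using 2 assms shear_right[of m u n] by (intro exI[of _ n] exI[of _ u]) auto
  qed
  have le: "shear m z \<le> shear m z'" if "z \<le> z'" for z z'
  proof -
    obtain n u where z: "z = of_int n * m + u" "-1 \<le> u" "u < m - 1" "shear m z \<le> of_int n * m + m - 1"
      "shear m z = of_int n * m + (if u \<le> 0 then (m - 1) * (u + 1) - 1 else m - 2 + u / (m - 1))"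
      using window[of z] by blast
    obtain n' u' where z': "z' = of_int n' * m + u'" "-1 \<le> u'" "u' < m - 1" "of_int n' * m - 1 \<le> shear m z'"
      "shear m z' = of_int n' * m + (if u' \<le> 0 then (m - 1) * (u' + 1) - 1 else m - 2 + u' / (m - 1))"
      using window[of z'] by blast
    consider "n < n'" | "n = n'" | "n' < n" by linarith
    then show ?thesis
    proof cases
      case 1
      then have "of_int (n + 1) * m \<le> of_int n' * m"
        using assms by (intro mult_right_mono) auto
      then show ?thesis
        using z(4) z'(4) by (simp add: algebra_simps)
    next
      case 2
      have "(m - 1) * (u + 1) - 1 \<le> (m - 1) * (u' + 1) - 1" "u / (m - 1) \<le> u' / (m - 1)"
        using that 2 z(1) z'(1) assms by (auto intro!: mult_left_mono divide_right_mono)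
      moreover have "(m - 1) * (u + 1) \<le> m - 1" if "u \<le> 0"
        using that z(2) assms by (simp add: mult_left_le)
      moreover have "0 \<le> u' / (m - 1)" if "0 \<le> u'"
        using that assms by simp
      moreover have "u \<le> u'"
        using that 2 z(1) z'(1) by simp
      ultimately show ?thesis
        unfolding z(5) z'(5) 2 by auto
    next
      case 3
      then have "of_int (n' + 1) * m \<le> of_int n * m"
        using assms by (intro mult_right_mono) auto
      then show ?thesis
        using that z(1,2) z'(1,3) by (simp add: algebra_simps)
    qed
  qed
  \<comment> \<open>A left inverse comes from \<open>shear_shift_shear\<close>; injectivity makes
    the weak monotonicity strict.\<close>
  have "inj (shear m)"
    by (rule inj_on_inverseI[of _ "\<lambda>z. shear m (z + 1) - m + 1"])
       (simp add: shear_shift_shear[OF assms])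
  then show ?thesis
    using le by (simp add: strict_mono_def less_le inj_eq)
qed

lemma bij_shear:
  assumes "m > 2"
  shows "bij (shear m)"
proof (rule bij_betw_byWitness[where f' = "\<lambda>z. shear m (z + 1) - (m - 1)"])
  show "\<forall>z\<in>UNIV. shear m (shear m (z + 1) - (m - 1)) = z"
  proof
    fix z
    \<comment> \<open>Subtracting \<open>m - 1\<close> amounts to adding 1 and going back one
      period.\<close>
    have "shear m (shear m (z + 1) - (m - 1)) = shear m (shear m (z + 1) + 1) - m"
      using shear_add_period[OF assms, of "shear m (z + 1) - (m - 1)" 1]
      by (simp add: algebra_simps)
    then show "shear m (shear m (z + 1) - (m - 1)) = z"
      by (simp add: shear_shift_shear[OF assms])
  qed
qed (auto simp: shear_shift_shear[OF assms])

section \<open>Homomorphisms from the Artin group\<close>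

lemma (in monoid) pow_mult_rotate:
  assumes "a \<in> carrier G" "b \<in> carrier G"
  shows "(a \<otimes> b) [^] n \<otimes> a = a \<otimes> (b \<otimes> a) [^] (n::nat)"
proof (induction n)
  case (Suc n)
  have "(a \<otimes> b) [^] Suc n \<otimes> a = ((a \<otimes> b) [^] n \<otimes> a) \<otimes> (b \<otimes> a)"
    using assms by (simp add: m_assoc)
  also have "\<dots> = a \<otimes> (b \<otimes> a) [^] Suc n"
    unfolding Suc.IH using assms by (simp add: m_assoc)
  finally show ?case .
qed (use assms in simp)

primrec word_val :: "('a, 'c) monoid_scheme \<Rightarrow> ('b \<Rightarrow> 'a) \<Rightarrow> 'b gword \<Rightarrow> 'a" where
  "word_val K f [] = \<one>\<^bsub>K\<^esub>"
| "word_val K f (l # u) = (if snd l then f (fst l) else inv\<^bsub>K\<^esub> f (fst l)) \<otimes>\<^bsub>K\<^esub> word_val K f u"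

context group
begin

lemma word_val_closed: "range f \<subseteq> carrier G \<Longrightarrow> word_val G f u \<in> carrier G"
  by (induction u) auto

lemma word_val_append:
  "range f \<subseteq> carrier G \<Longrightarrow> word_val G f (u @ v) = word_val G f u \<otimes> word_val G f v"
  by (induction u) (auto simp: m_assoc word_val_closed range_subsetD)

lemma word_val_cong:
  assumes "range f \<subseteq> carrier G" and "\<And>u v. (u, v) \<in> R \<Longrightarrow> word_val G f u = word_val G f v"
    and "pres_cong R u v"
  shows "word_val G f u = word_val G f v"
  using assms(3)
  by induction (use assms(1,2) in \<open>auto simp: word_val_append range_subsetD\<close>)

text \<open>Evaluation of words is constant on congruence classes once it respects the relators, so
  any representative serves to define \<open>h\<close> (von Dyck's theorem).\<close>

lemma presented_group_hom_exists:
  assumes f: "range f \<subseteq> carrier G"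
    and R: "\<And>u v. (u, v) \<in> R \<Longrightarrow> word_val G f u = word_val G f v"
  obtains h where "h \<in> hom (presented_group R) G" "\<And>u. h (pres_class R u) = word_val G f u"
proof -
  define h where "h A = word_val G f (SOME u. A = pres_class R u)" for A
  have h: "h (pres_class R u) = word_val G f u" for u
  proof -
    have "pres_class R u = pres_class R (SOME v. pres_class R u = pres_class R v)"
      by (rule someI[of _ u]) simp
    then show ?thesis
      unfolding h_def pres_class_eq_iff using word_val_cong[OF f R] by metis
  qed
  have "h \<in> hom (presented_group R) G"
    by (rule homI)
       (auto simp: presented_group_carrier presented_group_mult h word_val_append f word_val_closed)
  then show ?thesis
    using that h by blast
qed

end

lemma artin_I2_hom_exists:
  fixes K (structure)
  assumes "group K" and p: "p \<in> carrier K" and q: "q \<in> carrier K"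
    and rel: "list_prod K (alt_word p q m) = list_prod K (alt_word q p m)"
  obtains h where "h \<in> hom (artin_I2 m) K" "h (artin_s m) = p" "h (artin_t m) = q"
proof -
  interpret K: group K by fact
  define f where "f = case_artin_gen p q"
  have f: "range f \<subseteq> carrier K"
    using p q by (auto simp: f_def split: artin_gen.splits)
  have pos: "word_val K f (positive_word xs) = list_prod K (map f xs)" for xs
    by (induction xs) (auto simp: positive_word_def list_prod_def)
  have alt: "map f (alt_word x y n) = alt_word (f x) (f y) n" for x y n
    by (induction n arbitrary: x y) auto
  have "word_val K f u = word_val K f v" if "(u, v) \<in> artin_I2_rels m" for u v
    using that rel by (auto simp: artin_I2_rels_def pos alt) (auto simp: f_def)
  then obtain h where h: "h \<in> hom (presented_group (artin_I2_rels m)) K"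
    "\<And>u. h (pres_class (artin_I2_rels m) u) = word_val K f u"
    using K.presented_group_hom_exists[OF f] by metis
  show ?thesis
    by (rule that[of h]) (use h p q in \<open>auto simp: artin_I2_def artin_s_def artin_t_def positive_word_def f_def\<close>)
qed

text \<open>Both sides of the braid relation have \<open>m\<close> letters, so word length passes to
  the group. This degree bounds exponents and drives the inductions over \<open>M\<close>.\<close>

lemma artin_I2_len_exists:
  obtains len where "len \<in> hom (artin_I2 m) integer_group" "len (artin_s m) = 1" "len (artin_t m) = 1"
  by (rule artin_I2_hom_exists[OF group_integer_group, of 1 1 m]) auto

lemma artin_I2_generated: "carrier (artin_I2 m) = generate (artin_I2 m) {artin_s m, artin_t m}"
proof
  interpret group "artin_I2 m" by (rule group_artin_I2)
  let ?A = "{artin_s m, artin_t m}"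
  have A: "?A \<subseteq> carrier (artin_I2 m)"
    using artin_s_carrier artin_t_carrier by auto
  then show "generate (artin_I2 m) ?A \<subseteq> carrier (artin_I2 m)"
    by (simp add: generate_incl)
  have cons: "pres_class (artin_I2_rels m) (l # u) =
      pres_class (artin_I2_rels m) [l] \<otimes>\<^bsub>artin_I2 m\<^esub> pres_class (artin_I2_rels m) u" for l u
    by (simp add: artin_I2_def presented_group_mult)
  have pos: "pres_class (artin_I2_rels m) [(x, True)] \<in> ?A" for x
    by (cases x) (auto simp: artin_s_def artin_t_def positive_word_def)
  have neg: "pres_class (artin_I2_rels m) [(x, False)] =
      inv\<^bsub>artin_I2 m\<^esub> pres_class (artin_I2_rels m) [(x, True)]" for x
  proof (rule inv_equality[symmetric])
    show "pres_class (artin_I2_rels m) [(x, False)] \<otimes>\<^bsub>artin_I2 m\<^esub> pres_class (artin_I2_rels m) [(x, True)]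
        = \<one>\<^bsub>artin_I2 m\<^esub>"
      using pres_cong.cancel[of "artin_I2_rels m" x False]
      by (simp add: artin_I2_def presented_group_mult presented_group_one pres_class_eq_iff)
  qed (auto simp: artin_I2_def presented_group_carrier)
  have letter: "pres_class (artin_I2_rels m) [l] \<in> generate (artin_I2 m) ?A" for l
  proof (cases l)
    case (Pair x b)
    then show ?thesis
      using generate.incl[OF pos[of x]] generate.inv[OF pos[of x]] by (cases b) (simp_all add: neg)
  qed
  have "pres_class (artin_I2_rels m) u \<in> generate (artin_I2 m) ?A" for u
  proof (induction u)
    case Nil
    show ?case
      using generate.one[of "artin_I2 m" ?A] by (simp add: artin_I2_def presented_group_one)
  next
    case (Cons l u)
    then show ?case
      unfolding cons[of l u] by (intro generate.eng letter)
  qed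
  then show "carrier (artin_I2 m) \<subseteq> generate (artin_I2 m) ?A"
    by (auto simp: artin_I2_def presented_group_carrier)
qed

text \<open>The map for \<open>t\<close> is the map for \<open>s\<close> conjugated by the shift by
  1, and \<open>st\<close> acts as the translation \<open>\<xi> 1\<close>. The braid relation says
  that \<open>\<xi> k\<close> conjugates the first map into the second; it does, since
  \<open>k (m - 2) = (k - 1) m + 1\<close> differs from 1 by a multiple of the period.\<close>

lemma artin_I2_act_exists:
  assumes "k \<ge> 1"
  shows "\<exists>act.
    (\<forall>a\<in>carrier (artin_I2 (2 * k + 1)). \<forall>b\<in>carrier (artin_I2 (2 * k + 1)). \<forall>z.
      act (a \<otimes>\<^bsub>artin_I2 (2 * k + 1)\<^esub> b) z = act a (act b z)) \<and>
    act (artin_s (2 * k + 1)) = shear (real (2 * k + 1)) \<and>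
    act (artin_t (2 * k + 1)) = (\<lambda>z. shear (real (2 * k + 1)) (z - 1) + 1)"
proof -
  let ?K = "BijGroup (UNIV :: real set)" and ?m = "2 * k + 1"
  interpret K: group ?K by (rule group_BijGroup)
  define \<sigma> where "\<sigma> = shear ?m"
  define \<tau> where "\<tau> z = shear ?m (z - 1) + 1" for z
  define \<xi> where "\<xi> j z = z + real j * (real ?m - 2)" for j z
  have m2: "real ?m > 2"
    using assms by simp
  have Bij: "f \<in> Bij UNIV \<longleftrightarrow> bij f" for f :: "real \<Rightarrow> real"
    by (simp add: Bij_def)
  have mult: "f \<otimes>\<^bsub>?K\<^esub> g = f \<circ> g" if "bij f" "bij g" for f g
    using that by (simp add: BijGroup_def Bij compose_def o_def restrict_def)
  have \<sigma>: "bij \<sigma>"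
    unfolding \<sigma>_def by (rule bij_shear[OF m2])
  have "\<tau> = (\<lambda>z. z + 1) \<circ> \<sigma> \<circ> (\<lambda>z. z - 1)"
    by (auto simp: \<tau>_def \<sigma>_def)
  moreover have shift: "bij (\<lambda>z. z + c :: real)" for c
    by (rule bij_betw_byWitness[where f' = "\<lambda>z. z - c"]) auto
  moreover have "bij (\<lambda>z. z - 1 :: real)"
    using shift[of "-1"] by simp
  ultimately have \<tau>: "bij \<tau>"
    using \<sigma> by (metis bij_comp)
  have \<sigma>\<tau>: "\<sigma> \<otimes>\<^bsub>?K\<^esub> \<tau> = \<xi> 1"
    unfolding mult[OF \<sigma> \<tau>]
    by (auto simp: \<sigma>_def \<tau>_def \<xi>_def fun_eq_iff shear_shift_shear[OF m2, simplified])
  have \<xi>_bij: "bij (\<xi> j)" for j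
    unfolding \<xi>_def by (rule shift)
  have pow: "(\<sigma> \<otimes>\<^bsub>?K\<^esub> \<tau>) [^]\<^bsub>?K\<^esub> j = \<xi> j" for j
  proof (induction j)
    case 0
    then show ?case by (auto simp: BijGroup_def \<xi>_def)
  next
    case (Suc j)
    then show ?case
      by (simp add: \<sigma>\<tau> mult \<xi>_bij) (auto simp: \<xi>_def algebra_simps)
  qed
  have carr: "\<sigma> \<in> carrier ?K" "\<tau> \<in> carrier ?K"
    using \<sigma> \<tau> by (simp_all add: BijGroup_def Bij)
  have "list_prod ?K (alt_word \<sigma> \<tau> ?m) = \<xi> k \<circ> \<sigma>"
    using K.list_prod_alt_word_odd[OF carr, of k] by (simp add: pow mult \<xi>_bij \<sigma>)
  moreover have "list_prod ?K (alt_word \<tau> \<sigma> ?m) = \<tau> \<circ> \<xi> k"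
  proof -
    show ?thesis
      using K.list_prod_alt_word_odd[OF carr(2,1), of k] K.pow_mult_rotate[OF carr(2,1), of k] by (simp add: pow mult \<xi>_bij \<tau>)
  qed
  moreover have "\<xi> k \<circ> \<sigma> = \<tau> \<circ> \<xi> k"
  proof
    fix z
    have k: "real k * (real ?m - 2) = of_int (int k - 1) * real ?m + 1"
      by (simp add: algebra_simps)
    show "(\<xi> k \<circ> \<sigma>) z = (\<tau> \<circ> \<xi> k) z"
      using shear_add_period[OF m2, of z "int k - 1"]
      by (simp only: o_apply \<xi>_def \<tau>_def \<sigma>_def k) simp
  qed
  ultimately obtain h where h: "h \<in> hom (artin_I2 ?m) ?K" "h (artin_s ?m) = \<sigma>" "h (artin_t ?m) = \<tau>"
    using artin_I2_hom_exists[OF K.group_axioms carr, of ?m] by metis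
  show ?thesis
  proof (intro exI[of _ h] conjI ballI allI)
    fix a b z
    assume ab: "a \<in> carrier (artin_I2 ?m)" "b \<in> carrier (artin_I2 ?m)"
    then have "h a \<in> carrier ?K" "h b \<in> carrier ?K"
      using h(1) by (auto simp: hom_def)
    then show "h (a \<otimes>\<^bsub>artin_I2 ?m\<^esub> b) z = h a (h b z)"
      using hom_mult[OF h(1) ab] mult[of "h a" "h b"] by (simp add: BijGroup_def Bij)
  next
    show "h (artin_s ?m) = shear ?m"
      unfolding h(2) by (simp add: \<sigma>_def)
    show "h (artin_t ?m) = (\<lambda>z. shear ?m (z - 1) + 1)"
      unfolding h(3) by (auto simp: \<tau>_def)
  qed
qed

section \<open>Alternating forms and words\<close>

fun flip :: "artin_gen \<Rightarrow> artin_gen" where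
  "flip S_gen = T_gen"
| "flip T_gen = S_gen"

lemma flip_flip [simp]: "flip (flip x) = x"
  by (cases x) auto

lemma flip_neq [simp]: "flip x \<noteq> x" "x \<noteq> flip x"
  by (cases x; simp)+

lemma neq_iff_flip: "x \<noteq> y \<longleftrightarrow> x = flip y"
  by (cases x; cases y) auto

fun blocks :: "'b list \<Rightarrow> nat" where
  "blocks [] = 0"
| "blocks [x] = 1"
| "blocks (x # y # w) = (if x = y then 0 else 1) + blocks (y # w)"

lemma blocks_replicate: "e > 0 \<Longrightarrow> blocks (replicate e x) = 1"
proof (induction e)
  case (Suc e)
  then show ?case by (cases e) auto
qed simp

lemma blocks_append_replicate:
  assumes "w \<noteq> []" "last w \<noteq> x" "e > 0"
  shows "blocks (w @ replicate e x) = Suc (blocks w)"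
  using assms
proof (induction w rule: blocks.induct)
  case (2 y)
  then show ?case by (cases e) (auto simp: blocks_replicate[of "Suc _", simplified])
qed auto

section \<open>Products of lists and generated submonoids\<close>

lemma list_prod_Nil [simp]: "list_prod G [] = \<one>\<^bsub>G\<^esub>"
  and list_prod_Cons [simp]: "list_prod G (a # as) = a \<otimes>\<^bsub>G\<^esub> list_prod G as"
  by (simp_all add: list_prod_def)

lemma (in monoid) list_prod_closed: "set as \<subseteq> carrier G \<Longrightarrow> list_prod G as \<in> carrier G"
  by (induction as) auto

lemma (in monoid) list_prod_append:
  "\<lbrakk>set as \<subseteq> carrier G; set bs \<subseteq> carrier G\<rbrakk> \<Longrightarrow>
    list_prod G (as @ bs) = list_prod G as \<otimes> list_prod G bs"
  by (induction as) (auto simp: m_assoc list_prod_closed)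

lemma (in monoid) submonoid_generate_eq_list_prods:
  assumes "A \<subseteq> carrier G"
  shows "submonoid_generate G A = list_prod G ` lists A"
proof
  have "submonoid (list_prod G ` lists A) G"
  proof
    show "list_prod G ` lists A \<subseteq> carrier G"
      using assms by (auto intro!: list_prod_closed)
    show "x \<otimes> y \<in> list_prod G ` lists A"
      if "x \<in> list_prod G ` lists A" "y \<in> list_prod G ` lists A" for x y
    proof -
      obtain as bs where "as \<in> lists A" "bs \<in> lists A" "x = list_prod G as" "y = list_prod G bs"
        using \<open>x \<in> _\<close> \<open>y \<in> _\<close> by blast
      then show ?thesis
        using assms by (intro image_eqI[of _ _ "as @ bs"]) (auto simp: list_prod_append in_lists_conv_set subset_iff)
    qed
    show "\<one> \<in> list_prod G ` lists A"
      by (rule image_eqI[of _ _ "[]"]) auto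
  qed
  moreover have "A \<subseteq> list_prod G ` lists A"
    using assms by (auto intro!: image_eqI[of _ _ "[_]"])
  ultimately show "submonoid_generate G A \<subseteq> list_prod G ` lists A"
    by (auto simp: submonoid_generate_def)
  have "list_prod G as \<in> K" if "submonoid K G" "A \<subseteq> K" "as \<in> lists A" for K as
    using that(3,2) by induction (auto simp: submonoid.one_closed[OF that(1)] submonoid.m_closed[OF that(1)])
  then show "list_prod G ` lists A \<subseteq> submonoid_generate G A"
    by (auto simp: submonoid_generate_def)
qed

text \<open>Each parabolic monoid consists of the powers of one generator, so a degree map with both
  generators in degree 1 suffices to handle tails and alternating forms.\<close>

locale graded_two_generated = group G for G (structure) +
  fixes s t :: 'a and len :: "'a \<Rightarrow> int"
  assumes s_closed: "s \<in> carrier G" and t_closed: "t \<in> carrier G"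
    and len_hom: "len \<in> hom G integer_group"
    and len_s: "len s = 1" and len_t: "len t = 1"
begin

definition gen :: "artin_gen \<Rightarrow> 'a" where
  "gen = case_artin_gen s t"

definition val :: "artin_gen list \<Rightarrow> 'a" where
  "val w = list_prod G (map gen w)"

abbreviation M :: "'a set" where
  "M \<equiv> submonoid_generate G {s, t}"

abbreviation K :: "artin_gen \<Rightarrow> 'a set" where
  "K x \<equiv> submonoid_generate G {gen x}"

lemma gen_simps [simp]: "gen S_gen = s" "gen T_gen = t"
  by (simp_all add: gen_def)

lemma gen_closed [simp]: "gen x \<in> carrier G"
  by (cases x) (auto simp: s_closed t_closed)

lemma val_simps [simp]: "val [] = \<one>" "val (x # w) = gen x \<otimes> val w"
  by (simp_all add: val_def)

lemma val_closed [simp]: "val w \<in> carrier G"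
  by (induction w) auto

lemma val_append: "val (u @ v) = val u \<otimes> val v"
  by (induction u) (auto simp: m_assoc)

lemma val_replicate: "val (replicate n x) = gen x [^] n"
proof (induction n)
  case (Suc n)
  show ?case
    by (simp only: replicate_Suc val_simps Suc.IH nat_pow_Suc2[OF gen_closed])
qed simp

lemma M_eq: "M = range val"
proof -
  have "(UNIV :: artin_gen set) = {S_gen, T_gen}"
    by (auto intro: artin_gen.exhaust)
  then have "{s, t} = range gen"
    by (metis gen_simps image_empty image_insert)
  moreover have "range gen \<subseteq> carrier G"
    by auto
  ultimately show ?thesis
    using submonoid_generate_eq_list_prods[of "range gen"]
    by (simp add: val_def[abs_def] lists_image image_image)
qed

lemma M_closed: "a \<in> M \<Longrightarrow> a \<in> carrier G"
  by (auto simp: M_eq)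

lemma val_M [simp]: "val w \<in> M"
  by (simp add: M_eq)

lemma M_one [simp]: "\<one> \<in> M"
  using val_M[of "[]"] by simp

lemma M_mult: "\<lbrakk>a \<in> M; b \<in> M\<rbrakk> \<Longrightarrow> a \<otimes> b \<in> M"
  by (auto simp: M_eq val_append[symmetric])

lemma gen_pow_M [simp]: "gen x [^] (n::nat) \<in> M"
  by (metis val_replicate val_M)

lemma K_eq: "K x = range (\<lambda>n::nat. gen x [^] n)"
proof -
  have "lists {x} = range (\<lambda>n. replicate n x)"
    by (auto simp: in_lists_conv_set) (metis replicate_eqI rangeI)
  then have "lists {gen x} = range (\<lambda>n. map gen (replicate n x))"
    using lists_image[of gen "{x}"] by (simp only: image_image image_insert image_empty)
  then show ?thesis
    using submonoid_generate_eq_list_prods[of "{gen x}"]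
    by (simp only: image_image val_def[symmetric] val_replicate) simp
qed

lemma len_mult: "\<lbrakk>a \<in> carrier G; b \<in> carrier G\<rbrakk> \<Longrightarrow> len (a \<otimes> b) = len a + len b"
  using hom_mult[OF len_hom] by simp

lemma len_one [simp]: "len \<one> = 0"
  using len_mult[of \<one> \<one>] by simp

lemma len_inv: "a \<in> carrier G \<Longrightarrow> len (inv a) = - len a"
  using len_mult[of "inv a" a] by simp

lemma len_gen [simp]: "len (gen x) = 1"
  by (cases x) (auto simp: len_s len_t)

lemma len_val: "len (val w) = int (length w)"
  by (induction w) (auto simp: len_mult)

lemma len_M_nonneg: "a \<in> M \<Longrightarrow> len a \<ge> 0"
  by (auto simp: M_eq len_val)

lemma len_M_eq_0: "\<lbrakk>a \<in> M; len a = 0\<rbrakk> \<Longrightarrow> a = \<one>"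
  by (auto simp: M_eq len_val)

lemma len_gen_pow [simp]: "len (gen x [^] (n::nat)) = int n"
  using len_val[of "replicate n x"] by (simp add: val_replicate)

section \<open>Tails in the monoid of powers of one generator\<close>

lemma gen_pow_le_R_mono:
  fixes i j :: nat
  assumes "a \<in> M" "i \<le> j" "a \<otimes> inv (gen x [^] j) \<in> M"
  shows "a \<otimes> inv (gen x [^] i) \<in> M"
proof -
  have "inv (gen x [^] i) = inv (gen x [^] j) \<otimes> gen x [^] (j - i)"
  proof -
    have "gen x [^] j = gen x [^] (j - i) \<otimes> gen x [^] i"
      using assms by (simp add: nat_pow_mult)
    then show ?thesis
      by (simp add: inv_mult_group m_assoc)
  qed
  then have "a \<otimes> inv (gen x [^] i) = (a \<otimes> inv (gen x [^] j)) \<otimes> gen x [^] (j - i)"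
    using M_closed[OF assms(1)] by (simp add: m_assoc)
  then show ?thesis
    using M_mult[OF assms(3)] by simp
qed

lemma gen_pow_le_R_gen_pow: "le_R G M (gen x [^] i) (gen x [^] j) \<longleftrightarrow> i \<le> (j::nat)"
proof
  assume "le_R G M (gen x [^] i) (gen x [^] j)"
  then have "len (gen x [^] j \<otimes> inv (gen x [^] i)) \<ge> 0"
    by (simp add: le_R_def len_M_nonneg)
  then show "i \<le> j"
    by (simp add: len_mult len_inv)
next
  assume "i \<le> j"
  then show "le_R G M (gen x [^] i) (gen x [^] j)"
    using gen_pow_le_R_mono[of "gen x [^] j" i j x] by (simp add: le_R_def)
qed

text \<open>The powers of \<open>gen x\<close> that divide \<open>a\<close> form an initial segment
  of exponents, and so do those dividing \<open>gen x [^] j\<close>. Equality of the divisor sets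
  therefore fixes the exponent.\<close>

lemma tail_eqI:
  assumes "a \<in> M" and e: "a \<otimes> inv (gen x [^] e) \<in> M" and "a \<otimes> inv (gen x [^] Suc e) \<notin> M"
  shows "tail G M (K x) a = gen x [^] e"
proof -
  have le: "le_R G M (gen x [^] i) a \<longleftrightarrow> i \<le> e" for i
    unfolding le_R_def
    using gen_pow_le_R_mono[OF assms(1) _ e, of i] gen_pow_le_R_mono[OF assms(1), of "Suc e" i x] assms(3)
    by (meson not_less_eq_eq)
  have iff: "{c \<in> K x. le_R G M c a} = {c \<in> K x. le_R G M c (gen x [^] j)} \<longleftrightarrow> j = e" for j
  proof
    assume eq: "{c \<in> K x. le_R G M c a} = {c \<in> K x. le_R G M c (gen x [^] j)}"
    have "i \<le> e \<longleftrightarrow> i \<le> j" for i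
    proof -
      have "gen x [^] i \<in> K x" by (auto simp: K_eq)
      then have "le_R G M (gen x [^] i) a \<longleftrightarrow> le_R G M (gen x [^] i) (gen x [^] j)"
        using eq by blast
      then show ?thesis
        by (simp add: le gen_pow_le_R_gen_pow)
    qed
    then show "j = e"
      by (meson le_antisym order_refl)
  next
    assume "j = e"
    then show "{c \<in> K x. le_R G M c a} = {c \<in> K x. le_R G M c (gen x [^] j)}"
      by (auto simp: K_eq le gen_pow_le_R_gen_pow)
  qed
  show ?thesis
    unfolding tail_def
  proof (rule the_equality)
    show "gen x [^] e \<in> K x \<and> {c \<in> K x. le_R G M c a} = {c \<in> K x. le_R G M c (gen x [^] e)}"
      using iff[of e] by (auto simp: K_eq)
    show "b = gen x [^] e" if b: "b \<in> K x \<and> {c \<in> K x. le_R G M c a} = {c \<in> K x. le_R G M c b}" for b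
    proof -
      obtain j where "b = gen x [^] (j::nat)"
        using b by (auto simp: K_eq)
      then show ?thesis
        using b iff[of j] by blast
    qed
  qed
qed

text \<open>Exponent 0 always divides and the degree of \<open>a\<close> bounds all dividing
  exponents, so there is a last one.\<close>

lemma tail_exists:
  assumes "a \<in> M"
  obtains b e where "b \<in> M" "a = b \<otimes> gen x [^] (e::nat)" "tail G M (K x) a = gen x [^] e"
    "b \<otimes> inv (gen x) \<notin> M"
proof -
  let ?P = "\<lambda>e::nat. a \<otimes> inv (gen x [^] e) \<in> M"
  have a: "a \<in> carrier G"
    using assms by (rule M_closed)
  have bound: "int e \<le> len a" if "?P e" for e
    using len_M_nonneg[OF that] a by (simp add: len_mult len_inv)
  have "\<exists>e. ?P e \<and> \<not> ?P (Suc e)"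
  proof (rule ccontr)
    assume *: "\<nexists>e. ?P e \<and> \<not> ?P (Suc e)"
    have "?P e" for e
    proof (induction e)
      case 0
      then show ?case using assms a by simp
    qed (use * in blast)
    then have "int (Suc (nat (len a))) \<le> len a"
      using bound by blast
    then show False
      by linarith
  qed
  then obtain e where e: "?P e" "\<not> ?P (Suc e)" by blast
  have "a = a \<otimes> inv (gen x [^] e) \<otimes> gen x [^] e"
    using a by (simp add: m_assoc)
  moreover have "a \<otimes> inv (gen x [^] e) \<otimes> inv (gen x) = a \<otimes> inv (gen x [^] Suc e)"
    using a by (simp add: m_assoc inv_mult_group[symmetric] nat_pow_Suc2[symmetric] del: nat_pow_Suc)
  ultimately show ?thesis
    using that[of "a \<otimes> inv (gen x [^] e)" e] e tail_eqI[OF assms e] by metis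
qed

lemma divisible_by_last:
  assumes "w \<noteq> []"
  shows "val w \<otimes> inv (gen (last w)) = val (butlast w)"
proof -
  have "val w = val (butlast w) \<otimes> gen (last w)"
    using assms val_append[of "butlast w" "[last w]"] by simp
  then show ?thesis
    by (simp add: m_assoc)
qed

lemma alternating_form_Nil: "\<not> is_alternating_form G M A B a []"
  by (simp add: is_alternating_form_def)

lemma alternating_form_single:
  "is_alternating_form G M A B a [c] \<longleftrightarrow> c \<in> M \<and> c \<noteq> \<one> \<and> c = a \<and> c = tail G M A a"
  using M_closed[of c] by (auto simp: is_alternating_form_def)

text \<open>Factors are numbered from the right. Removing the last one lowers every index by 1 and
  so exchanges odd and even, hence the swap of \<open>A\<close> and \<open>B\<close>.\<close>

lemma alternating_form_snoc:
  assumes "as \<noteq> []"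
  shows "is_alternating_form G M A B a (as @ [c]) \<longleftrightarrow>
    is_alternating_form G M B A (list_prod G as) as \<and> c \<in> M \<and> a = list_prod G as \<otimes> c \<and> c = tail G M A a"
    (is "?L \<longleftrightarrow> ?R")
proof -
  let ?n = "length as"
  let ?I = "\<lambda>A B as i. as ! (length as - i) =
      tail G M (if odd i then A else B) (list_prod G (take (length as - i + 1) as))"
  have E: "{1..length (as @ [c])} = insert 1 (Suc ` {1..?n})"
    by (auto simp: image_iff)
  have F1: "?I A B (as @ [c]) 1 \<longleftrightarrow> c = tail G M A (list_prod G (as @ [c]))"
    by simp
  have F2: "?I A B (as @ [c]) (Suc i) \<longleftrightarrow> ?I B A as i" if "i \<in> {1..?n}" for i
    using that by (auto simp: nth_append)
  have I: "(\<forall>i\<in>{1..length (as @ [c])}. ?I A B (as @ [c]) i) \<longleftrightarrow>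
      c = tail G M A (list_prod G (as @ [c])) \<and> (\<forall>i\<in>{1..?n}. ?I B A as i)"
    unfolding E ball_simps F1 using F2 by blast
  have P: "list_prod G (as @ [c]) = list_prod G as \<otimes> c" if "set as \<subseteq> M" "c \<in> M"
    using that M_closed list_prod_append[of as "[c]"] by auto
  show ?thesis
    unfolding is_alternating_form_def I using assms P by auto
qed

lemma alternating_form_last:
  "is_alternating_form G M A B a (as @ [c]) \<Longrightarrow> c = tail G M A a"
  by (metis alternating_form_single alternating_form_snoc append_Nil)

text \<open>The last factor is forced to be the tail, so the forms can be peeled from the right.
  What remains is to exclude that one form stops while the other continues.\<close>

lemma alternating_form_unique:
  assumes "is_alternating_form G M A B a as" "is_alternating_form G M A B a bs"
  shows "as = bs"
  using assms
proof (induction as arbitrary: a bs A B rule: rev_induct)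
  case Nil
  then show ?case by (simp add: alternating_form_Nil)
next
  case (snoc c as)
  obtain d bs' where bs: "bs = bs' @ [d]"
    using snoc.prems(2) by (metis alternating_form_Nil rev_exhaust)
  have c: "c = tail G M A a" and d: "d = c"
    using alternating_form_last snoc.prems unfolding bs by metis+
  \<comment> \<open>The surplus factors have product 1, so by degree each of them is 1, against the
    nontrivial leading factor.\<close>
  have *: False if form: "is_alternating_form G M A B c (fs @ [c])" and ne: "fs \<noteq> []" for fs A B
  proof -
    have fs: "is_alternating_form G M B A (list_prod G fs) fs" "c \<in> M" "c = list_prod G fs \<otimes> c"
      using form alternating_form_snoc[OF ne] by blast+
    have "set fs \<subseteq> M" "hd fs \<noteq> \<one>"
      using fs(1) by (auto simp: is_alternating_form_def)
    have M: "list_prod G xs \<in> M" if "set xs \<subseteq> M" for xs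
      using that by (induction xs) (auto intro: M_mult)
    have "list_prod G fs = \<one>"
      using r_cancel_one'[OF M_closed[OF fs(2)] M_closed[OF M[OF \<open>set fs \<subseteq> M\<close>]]] fs(3) by blast
    moreover obtain f fs' where f: "fs = f # fs'"
      using ne by (cases fs) auto
    moreover have "f \<in> carrier G" "list_prod G fs' \<in> carrier G"
      using \<open>set fs \<subseteq> M\<close> M[of fs'] M_closed f by auto
    ultimately have "len f + len (list_prod G fs') = 0"
      using len_mult[of f "list_prod G fs'"] by simp
    then have "len f = 0"
      using \<open>set fs \<subseteq> M\<close> M[of fs'] f len_M_nonneg[of f] len_M_nonneg[of "list_prod G fs'"] by simp
    then show False
      using \<open>set fs \<subseteq> M\<close> \<open>hd fs \<noteq> \<one>\<close> f len_M_eq_0[of f] by simp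
  qed
  consider "as = []" "bs' = []" | "as = []" "bs' \<noteq> []" | "as \<noteq> []" "bs' = []" | "as \<noteq> []" "bs' \<noteq> []"
    by blast
  then show ?case
  proof cases
    case 2
    then show ?thesis
      using snoc.prems alternating_form_single[of A B a c] *[of A B bs'] unfolding bs d by auto
  next
    case 3
    then show ?thesis
      using snoc.prems alternating_form_single[of A B a d] *[of A B as] unfolding bs d by auto
  next
    case 4
    have as: "is_alternating_form G M B A (list_prod G as) as" "c \<in> M" "a = list_prod G as \<otimes> c"
      using snoc.prems(1) alternating_form_snoc[OF 4(1)] by blast+
    have bs': "is_alternating_form G M B A (list_prod G bs') bs'" "a = list_prod G bs' \<otimes> c"
      using snoc.prems(2) alternating_form_snoc[OF 4(2)] unfolding bs d by blast+
    have "list_prod G as \<in> carrier G" "list_prod G bs' \<in> carrier G"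
      using as(1) bs'(1) by (auto simp: is_alternating_form_def intro!: list_prod_closed dest: M_closed)
    then have "list_prod G as = list_prod G bs'"
      using right_cancel[OF M_closed[OF as(2)]] as(3) bs'(2) by metis
    then show ?thesis
      using snoc.IH as(1) bs'(1) unfolding bs d by metis
  qed (simp add: bs d)
qed

lemma breadth_eqI:
  assumes "a \<noteq> \<one>" "is_alternating_form G M A B a as"
  shows "breadth G M A B a = length as"
  unfolding breadth_def using assms(1)
  by (auto intro!: the_equality exI[of _ as] assms(2) dest: alternating_form_unique[OF assms(2)])

text \<open>As \<open>gen (flip x)\<close> does not divide \<open>a\<close>, every word for
  \<open>a\<close> ends in \<open>x\<close> and the tail is a nontrivial power. Stripping it leaves
  an element not divisible by \<open>gen x\<close>, so the induction continues with
  \<open>flip x\<close>. Concatenating the powers yields a word with one block per factor.\<close>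

lemma alternating_form_exists:
  assumes "a \<in> M" "a \<noteq> \<one>" "a \<otimes> inv (gen (flip x)) \<notin> M"
  shows "\<exists>as w. is_alternating_form G M (K x) (K (flip x)) a as \<and>
    val w = a \<and> w \<noteq> [] \<and> last w = x \<and> blocks w = length as"
  using assms
proof (induction "nat (len a)" arbitrary: a x rule: less_induct)
  case less
  obtain b e where b: "b \<in> M" "a = b \<otimes> gen x [^] (e::nat)" "tail G M (K x) a = gen x [^] e"
    "b \<otimes> inv (gen x) \<notin> M"
    using tail_exists[OF less.prems(1)] by metis
  obtain u where u: "a = val u"
    using less.prems(1) by (auto simp: M_eq)
  have "u \<noteq> []"
    using u less.prems(2) by auto
  have "last u = x"
    using divisible_by_last[OF \<open>u \<noteq> []\<close>] less.prems(3) u neq_iff_flip[of "last u" x] val_M by metis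
  have "e > 0"
  proof (rule ccontr)
    assume "\<not> e > 0"
    then have "a = b"
      using b(1,2) M_closed by auto
    then show False
      using b(4) divisible_by_last[of u] u \<open>last u = x\<close> \<open>u \<noteq> []\<close> by auto
  qed
  show ?case
  proof (cases "b = \<one>")
    case True
    then show ?thesis
      using b less.prems(2) \<open>e > 0\<close>
      by (intro exI[of _ "[a]"] exI[of _ "replicate e x"])
        (auto simp: alternating_form_single val_replicate blocks_replicate)
  next
    case False
    have "len a = len b + int e"
      using b(1,2) M_closed by (simp add: len_mult)
    then have "nat (len b) < nat (len a)"
      using \<open>e > 0\<close> len_M_nonneg[OF b(1)] by simp
    then obtain as w where w: "is_alternating_form G M (K (flip x)) (K x) b as" "val w = b" "w \<noteq> []"
      "last w = flip x" "blocks w = length as"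
      using less.hyps[of b "flip x"] b(1,4) False by auto
    moreover have "as \<noteq> []" "list_prod G as = b"
      using w(1) by (auto simp: is_alternating_form_def)
    ultimately show ?thesis
      using b \<open>e > 0\<close>
      by (intro exI[of _ "as @ [gen x [^] e]"] exI[of _ "w @ replicate e x"])
        (auto simp: alternating_form_snoc val_append val_replicate blocks_append_replicate)
  qed
qed

text \<open>The first tail, in the powers of \<open>t\<close>, may be trivial but still counts as a
  factor; the remaining factors are the blocks of \<open>w\<close>. Hence the breadth is
  \<open>Suc (blocks w)\<close>.\<close>

lemma depth_word:
  assumes "a \<in> M"
  obtains w e where "a = val w \<otimes> t [^] (e::nat)" "val w \<otimes> inv t \<notin> M" "w \<noteq> [] \<Longrightarrow> last w = S_gen"
    "depth G M (submonoid_generate G {t}) (submonoid_generate G {s}) a = Suc (blocks w) div 2"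
proof -
  let ?M1 = "submonoid_generate G {t}" and ?N = "submonoid_generate G {s}"
  \<comment> \<open>For an odd breadth \<open>p\<close>, \<open>(p - 1) div 2\<close> and
    \<open>p div 2\<close> coincide.\<close>
  have depth: "depth G M ?M1 ?N a = breadth G M ?M1 ?N a div 2"
    by (auto simp: depth_def elim!: oddE)
  obtain b e where b: "b \<in> M" "a = b \<otimes> t [^] (e::nat)" "tail G M ?M1 a = t [^] e" "b \<otimes> inv t \<notin> M"
    using tail_exists[OF assms, of T_gen] by auto
  show ?thesis
  proof (cases "b = \<one>")
    case True
    \<comment> \<open>The convention that 1 has breadth 1 makes \<open>a = \<one>\<close> agree with
      the formula for the empty word.\<close>
    have "breadth G M ?M1 ?N a = 1"
    proof (cases "a = \<one>")
      case False
      then show ?thesis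
        using b True t_closed assms breadth_eqI[of a ?M1 ?N "[a]"] by (simp add: alternating_form_single)
    qed (simp add: breadth_def)
    then show ?thesis
      using that[of "[]" e] b True depth by simp
  next
    case False
    then obtain as w where w: "is_alternating_form G M ?N ?M1 b as" "val w = b" "w \<noteq> []"
      "last w = S_gen" "blocks w = length as"
      using alternating_form_exists[of b S_gen] b by auto
    have "as \<noteq> []" "list_prod G as = b"
      using w(1) by (auto simp: is_alternating_form_def)
    then have "is_alternating_form G M ?M1 ?N a (as @ [t [^] e])"
      using b w(1) gen_pow_M[of T_gen e] by (simp add: alternating_form_snoc)
    moreover have "a \<noteq> \<one>"
    proof
      assume "a = \<one>"
      then have "len b + int e = 0"
        using b(1,2) M_closed len_gen_pow[of T_gen e] len_mult[of b "t [^] e"] t_closed by simp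
      then show False
        using len_M_nonneg[OF b(1)] len_M_eq_0[OF b(1)] False by linarith
    qed
    ultimately have "breadth G M ?M1 ?N a = Suc (blocks w)"
      using breadth_eqI w(5) by simp
    then show ?thesis
      using that[of w e] b w depth by simp
  qed
qed

end

section \<open>The action on the line\<close>

locale dihedral_artin_action = graded_two_generated +
  fixes k :: nat and act :: "'a \<Rightarrow> real \<Rightarrow> real"
  assumes k_pos: "k \<ge> 1"
    and generated: "carrier G = generate G {s, t}"
    and braid: "(s \<otimes> t) [^] k \<otimes> s = (t \<otimes> s) [^] k \<otimes> t"
    and act_mult: "\<lbrakk>a \<in> carrier G; b \<in> carrier G\<rbrakk> \<Longrightarrow> act (a \<otimes> b) z = act a (act b z)"
    and act_s: "act s = shear (real (2 * k + 1))"
    and act_t: "act t = (\<lambda>z. shear (real (2 * k + 1)) (z - 1) + 1)"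
begin

definition m :: real where
  "m = real (2 * k + 1)"

definition X :: 'a where
  "X = s \<otimes> t"

definition \<Omega> :: 'a where
  "\<Omega> = X [^] k \<otimes> s"

definition \<Delta> :: 'a where
  "\<Delta> = \<Omega> \<otimes> \<Omega>"

text \<open>As \<open>X\<close> translates and \<open>t\<close> fixes 0, the position of 0 under
  such an element determines \<open>i\<close>. Elements of \<open>M\<close> that move 0 to a
  multiple of \<open>m\<close> turn out to have this form, which leads to the stabiliser of
  0.\<close>

definition XT :: "'a set" where
  "XT = {X [^] i \<otimes> t [^] j | (i::int) (j::int). True}"

declare s_closed [simp] t_closed [simp]

lemma m_ge: "m \<ge> 3"
  using k_pos by (simp add: m_def)

lemma X_closed [simp]: "X \<in> carrier G" and \<Omega>_closed [simp]: "\<Omega> \<in> carrier G"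
  and \<Delta>_closed [simp]: "\<Delta> \<in> carrier G"
  by (simp_all add: X_def \<Omega>_def \<Delta>_def)

section \<open>The element \<open>\<Omega>\<close> and the centrality of
  \<open>\<Delta>\<close>\<close>

lemma s_eq: "s = X \<otimes> inv t"
  by (simp add: X_def m_assoc)

lemma \<Omega>_eq_t: "\<Omega> = t \<otimes> X [^] k"
  using pow_mult_rotate[of t s k] by (simp add: \<Omega>_def X_def braid)

text \<open>The two spellings \<open>X [^] k \<otimes> s\<close> and
  \<open>t \<otimes> X [^] k\<close> of \<open>\<Omega>\<close> show that
  \<open>s \<otimes> \<Omega>\<close> and \<open>\<Omega> \<otimes> t\<close> both equal
  \<open>X [^] Suc k\<close>, and that \<open>t \<otimes> \<Omega>\<close> and
  \<open>\<Omega> \<otimes> s\<close> both equal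
  \<open>t \<otimes> X [^] k \<otimes> s\<close>.\<close>

lemma gen_\<Omega>: "gen x \<otimes> \<Omega> = \<Omega> \<otimes> gen (flip x)"
proof -
  have "s \<otimes> \<Omega> = X [^] Suc k"
    by (simp only: \<Omega>_eq_t m_assoc[symmetric] X_closed s_closed t_closed nat_pow_closed nat_pow_Suc2 X_def[symmetric])
  moreover have "\<Omega> \<otimes> t = X [^] Suc k"
    by (simp add: \<Omega>_def m_assoc X_def[symmetric])
  moreover have "t \<otimes> \<Omega> = \<Omega> \<otimes> s"
  proof -
    have "t \<otimes> \<Omega> = t \<otimes> X [^] k \<otimes> s"
      by (simp add: \<Omega>_def m_assoc)
    then show ?thesis
      by (simp add: \<Omega>_eq_t)
  qed
  ultimately show ?thesis
    by (cases x) simp_all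
qed

lemma \<Omega>_val: "\<Omega> \<otimes> val w = val (map flip w) \<otimes> \<Omega>"
proof (induction w)
  case (Cons x w)
  have "\<Omega> \<otimes> val (x # w) = \<Omega> \<otimes> gen x \<otimes> val w"
    by (simp add: m_assoc)
  also have "\<dots> = gen (flip x) \<otimes> (\<Omega> \<otimes> val w)"
    using gen_\<Omega>[of "flip x"] by (simp add: m_assoc[symmetric])
  also have "\<dots> = val (map flip (x # w)) \<otimes> \<Omega>"
    by (simp add: Cons.IH m_assoc)
  finally show ?case .
qed simp

lemma val_alt_word:
  assumes "x \<noteq> y"
  shows "val (alt_word x y (2 * k + 1)) = \<Omega>"
proof -
  have alt: "map gen (alt_word x y n) = alt_word (gen x) (gen y) n" for x y n
    by (induction n arbitrary: x y) auto
  have "val (alt_word x y (2 * k + 1)) = (gen x \<otimes> gen y) [^] k \<otimes> gen x"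
    unfolding val_def alt by (rule list_prod_alt_word_odd) auto
  moreover have "(t \<otimes> s) [^] k \<otimes> t = \<Omega>"
    by (simp add: \<Omega>_def X_def braid)
  ultimately show ?thesis
    using assms by (cases x; cases y) (auto simp: \<Omega>_def X_def)
qed

text \<open>The factor \<open>\<Omega>\<close> can be moved to the right end at the cost of flipping
  the letters of \<open>v\<close>, and there its spelling ending in \<open>t\<close> is
  available.\<close>

lemma \<Omega>_factor_divisible:
  assumes "x \<noteq> y"
  shows "val (u @ alt_word x y (2 * k + 1) @ v) \<otimes> inv t \<in> M"
proof -
  have "val (u @ alt_word x y (2 * k + 1) @ v) = val u \<otimes> (\<Omega> \<otimes> val v)"
    unfolding val_append val_alt_word[OF assms] ..
  also have "\<dots> = val (u @ map flip v) \<otimes> \<Omega>"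
    by (simp add: \<Omega>_val val_append m_assoc)
  finally have eq: "val (u @ alt_word x y (2 * k + 1) @ v) = val (u @ map flip v) \<otimes> \<Omega>" .
  have ts: "(t \<otimes> s) [^] n \<in> M" for n :: nat
  proof (induction n)
    case (Suc n)
    then show ?case
      using M_mult[OF Suc val_M[of "[T_gen, S_gen]"]] by simp
  qed simp
  have "\<Omega> \<otimes> inv t = (t \<otimes> s) [^] k"
    unfolding \<Omega>_def X_def braid by (simp add: m_assoc)
  then have "\<Omega> \<otimes> inv t \<in> M"
    using ts by simp
  then show ?thesis
    unfolding eq using M_mult[OF val_M[of "u @ map flip v"]] by (simp add: m_assoc)
qed

lemma \<Delta>_eq: "\<Delta> = X [^] (2 * k + 1)"
proof -
  have "\<Delta> = X [^] k \<otimes> (s \<otimes> (t \<otimes> X [^] k))"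
    unfolding \<Delta>_def by (subst (2) \<Omega>_eq_t) (simp add: \<Omega>_def m_assoc)
  also have "s \<otimes> (t \<otimes> X [^] k) = X [^] Suc k"
    using nat_pow_Suc2[OF X_closed, of k] by (simp add: m_assoc[symmetric] X_def)
  also have "X [^] k \<otimes> X [^] Suc k = X [^] (k + Suc k)"
    by (rule nat_pow_mult) simp
  also have "k + Suc k = 2 * k + 1"
    by simp
  finally show ?thesis .
qed

lemma inv_commute:
  assumes "a \<in> carrier G" "b \<in> carrier G" "a \<otimes> b = b \<otimes> a"
  shows "inv a \<otimes> b = b \<otimes> inv a"
proof -
  have "inv a \<otimes> b = inv a \<otimes> (b \<otimes> a) \<otimes> inv a"
    using assms(1,2) by (simp add: m_assoc)
  also have "\<dots> = inv a \<otimes> a \<otimes> b \<otimes> inv a"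
    unfolding assms(3)[symmetric] using assms(1,2) by (simp only: m_assoc m_closed inv_closed)
  also have "\<dots> = b \<otimes> inv a"
    using assms(1,2) by simp
  finally show ?thesis .
qed

text \<open>Passing \<open>\<Omega>\<close> swaps the generators, so passing its square restores
  them.\<close>

lemma \<Delta>_central:
  assumes "a \<in> carrier G"
  shows "a \<otimes> \<Delta> = \<Delta> \<otimes> a"
proof -
  have gen: "gen x \<otimes> \<Delta> = \<Delta> \<otimes> gen x" for x
  proof -
    have "gen x \<otimes> \<Delta> = gen x \<otimes> \<Omega> \<otimes> \<Omega>"
      by (simp add: \<Delta>_def m_assoc)
    also have "\<dots> = \<Omega> \<otimes> (gen (flip x) \<otimes> \<Omega>)"
      by (simp add: gen_\<Omega> m_assoc)
    also have "\<dots> = \<Delta> \<otimes> gen x"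
      by (simp add: gen_\<Omega> \<Delta>_def m_assoc)
    finally show ?thesis .
  qed
  have "a \<in> generate G {s, t}"
    using assms generated by simp
  then show ?thesis
  proof induction
    case (incl h)
    then show ?case using gen[of S_gen] gen[of T_gen] by auto
  next
    case (inv h)
    then have "h \<otimes> \<Delta> = \<Delta> \<otimes> h" "h \<in> carrier G" using gen[of S_gen] gen[of T_gen] by auto
    then show ?case
      using inv_commute by simp
  next
    case (eng h1 h2)
    then have "h1 \<in> carrier G" "h2 \<in> carrier G" using generated by auto
    then show ?case using eng.IH by (metis \<Delta>_closed m_assoc)
  qed simp
qed

section \<open>Images of points under generators and powers\<close>

lemma act_s_m: "act s = shear m" and act_t_m: "act t = (\<lambda>z. shear m (z - 1) + 1)"
  by (simp_all only: act_s act_t m_def)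

lemma strict_mono_act_gen: "strict_mono (act (gen x))"
proof -
  have "strict_mono (shear m)"
    using strict_mono_shear m_ge by simp
  then show ?thesis
    by (cases x) (auto simp: act_s_m act_t_m strict_mono_def)
qed

lemma act_one [simp]: "act \<one> z = z"
proof -
  \<comment> \<open>Multiplicativity only makes \<open>act \<one>\<close> idempotent; cancelling the
    injective \<open>act s\<close> identifies it.\<close>
  have "act s (act \<one> z) = act s z"
    using act_mult[of s \<one> z] by simp
  then show ?thesis
    using strict_mono_eq[OF strict_mono_act_gen[of S_gen]] by simp
qed

lemma act_inv_cancel [simp]:
  "a \<in> carrier G \<Longrightarrow> act (inv a) (act a z) = z" "a \<in> carrier G \<Longrightarrow> act a (act (inv a) z) = z"
  using act_mult[of "inv a" a z] act_mult[of a "inv a" z] by simp_all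

lemma act_X: "act X z = z + (m - 2)"
  using shear_shift_shear[of m "z - 1"] m_ge
  by (simp add: X_def act_mult) (simp add: act_s_m act_t_m)

lemma act_X_int_pow: "act (X [^] (i::int)) z = z + of_int i * (m - 2)"
proof -
  have nat: "act (X [^] n) z = z + real n * (m - 2)" for n :: nat and z
    by (induction n arbitrary: z) (simp_all add: act_mult act_X algebra_simps)
  have inv: "act (inv (X [^] n)) z = z - real n * (m - 2)" for n :: nat and z
    using act_inv_cancel(2)[of "X [^] n" z] by (simp add: nat)
  show ?thesis
  proof (cases i rule: int_cases2)
    case (nonneg n)
    show ?thesis unfolding nonneg int_pow_int nat by simp
  next
    case (nonpos n)
    show ?thesis unfolding nonpos int_pow_neg_int[OF X_closed] inv by simp
  qed
qed

lemma act_\<Delta>_int_pow: "act (\<Delta> [^] (i::int)) z = z + of_int i * (m - 2) * m"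
proof -
  have A: "\<Delta> [^] i = X [^] (int (2 * k + 1) * i)"
    unfolding \<Delta>_eq by (metis X_closed int_pow_int int_pow_pow)
  have B: "real_of_int (int (2 * k + 1) * i) = m * of_int i"
    by (simp add: m_def)
  show ?thesis
    unfolding A act_X_int_pow B by simp
qed

lemma act_s_at: "act s (of_int n * m) = of_int n * m + m - 2"
  using shear_left[of m 0 n] m_ge by (simp add: act_s_m)

lemma act_s_fix: "act s (of_int n * m + m - 1) = of_int n * m + m - 1"
  using shear_right[of m "m - 1" n] m_ge by (simp add: act_s_m add_diff_eq)

lemma act_t_fix: "act t (of_int n * m) = of_int n * m"
  using shear_left[of m "-1" n] m_ge by (simp add: act_t_m)

lemma act_t_at: "act t (of_int n * m + 1) = of_int n * m + m - 1"
  using shear_left[of m 0 n] m_ge by (simp add: act_t_m)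

lemma act_t_int_pow_0: "act (t [^] (i::int)) 0 = 0"
proof -
  have nat: "act (t [^] n) 0 = 0" for n :: nat
    using act_t_fix[of 0] by (induction n) (simp_all add: act_mult)
  have inv: "act (inv (t [^] n)) 0 = 0" for n :: nat
    using act_inv_cancel(1)[of "t [^] n" 0] by (simp add: nat)
  show ?thesis
  proof (cases i rule: int_cases2)
    case (nonneg n)
    show ?thesis unfolding nonneg int_pow_int nat ..
  next
    case (nonpos n)
    show ?thesis unfolding nonpos int_pow_neg_int[OF t_closed] inv ..
  qed
qed

section \<open>Elements of the form \<open>X [^] i \<otimes> t [^] j\<close>\<close>

lemma XT_closed: "g \<in> XT \<Longrightarrow> g \<in> carrier G"
  by (auto simp: XT_def)

lemma t_pow_XT: "t [^] (j::int) \<in> XT"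
  unfolding XT_def by (rule CollectI, rule exI[of _ 0], rule exI[of _ j]) simp

lemma X_mult_XT: "g \<in> XT \<Longrightarrow> X \<otimes> g \<in> XT"
proof -
  assume "g \<in> XT"
  then obtain i j :: int where "g = X [^] i \<otimes> t [^] j" by (auto simp: XT_def)
  then have "X \<otimes> g = X [^] (1 + i) \<otimes> t [^] j"
    by (simp add: int_pow_mult m_assoc)
  then show ?thesis by (auto simp: XT_def)
qed

lemma XT_shift: "X [^] (i::int) \<otimes> (X \<otimes> inv t) \<otimes> t [^] (j::int) \<in> XT"
proof -
  have "X [^] (i + 1) = X [^] i \<otimes> X"
    by (simp add: int_pow_mult)
  moreover have "t [^] (-1 + j) = inv t \<otimes> t [^] j"
    by (subst int_pow_mult) (simp_all add: int_pow_neg)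
  ultimately have "X [^] i \<otimes> (X \<otimes> inv t) \<otimes> t [^] j = X [^] (i + 1) \<otimes> t [^] (-1 + j)"
    by (simp add: m_assoc)
  then show ?thesis
    unfolding XT_def by blast
qed

lemma act_XT: "act (X [^] (i::int) \<otimes> t [^] (j::int)) 0 = of_int i * (m - 2)"
  by (simp add: act_mult act_t_int_pow_0 act_X_int_pow)

text \<open>Modulo \<open>m\<close> the equation reads \<open>2 i = 0\<close>, and \<open>m\<close>
  is odd.\<close>

lemma multiple_of_m:
  fixes i n :: int
  assumes "of_int i * (m - 2) = of_int n * m"
  obtains q where "i = int (2 * k + 1) * q"
proof -
  have "of_int (i * (int (2 * k + 1) - 2)) = (of_int (n * int (2 * k + 1)) :: real)"
    using assms by (simp add: m_def)
  then have "i * (int (2 * k + 1) - 2) = n * int (2 * k + 1)"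
    by (simp only: of_int_eq_iff)
  then have "int (2 * k + 1) * (i - n) = 2 * i"
    by (simp add: algebra_simps)
  then have "int (2 * k + 1) dvd 2 * i"
    by (metis dvd_triv_left)
  moreover have "coprime (int (2 * k + 1)) 2"
    by (simp add: coprime_right_2_iff_odd)
  ultimately have "int (2 * k + 1) dvd i"
    by (simp add: coprime_dvd_mult_right_iff)
  then show ?thesis
    using that by (auto simp: dvd_def)
qed

lemma int_pow_commute:
  assumes "a \<in> carrier G" "b \<in> carrier G" "a \<otimes> b = b \<otimes> a"
  shows "a [^] (i::int) \<otimes> b = b \<otimes> a [^] i"
proof -
  have nat: "a [^] n \<otimes> b = b \<otimes> a [^] n" for n :: nat
    using group_commutes_pow assms by blast
  have inv: "inv (a [^] n) \<otimes> b = b \<otimes> inv (a [^] n)" for n :: nat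
    using inv_commute[of "a [^] n" b] nat assms by simp
  show ?thesis
    unfolding int_pow_def2 using nat inv by presburger
qed

lemma X_pow_central:
  assumes "a \<in> carrier G"
  shows "a \<otimes> X [^] (int (2 * k + 1) * q) = X [^] (int (2 * k + 1) * q) \<otimes> a"
proof -
  have "X [^] (int (2 * k + 1) * q) = \<Delta> [^] q"
    unfolding \<Delta>_eq by (metis X_closed int_pow_int int_pow_pow)
  moreover have "\<Delta> [^] q \<otimes> a = a \<otimes> \<Delta> [^] q"
    by (metis assms \<Delta>_closed \<Delta>_central int_pow_commute)
  ultimately show ?thesis by simp
qed

text \<open>The hypothesis on the position makes \<open>m\<close> divide \<open>i\<close>, so
  \<open>X [^] i\<close> is central. Then \<open>s\<close>, which is
  \<open>X \<otimes> inv t\<close>, moves past it and is absorbed.\<close>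

lemma s_mult_XT:
  assumes "g \<in> XT" "act g 0 = of_int n * m"
  shows "s \<otimes> g \<in> XT"
proof -
  obtain i j :: int where g: "g = X [^] i \<otimes> t [^] j"
    using assms(1) by (auto simp: XT_def)
  obtain q where i: "i = int (2 * k + 1) * q"
    using multiple_of_m[of i n] assms(2) by (auto simp: g act_XT)
  have "s \<otimes> g = X [^] i \<otimes> (X \<otimes> inv t) \<otimes> t [^] j"
    unfolding g i s_eq[symmetric] using X_pow_central[of s q] by (simp add: m_assoc[symmetric])
  also have "\<dots> \<in> XT"
    by (rule XT_shift)
  finally show ?thesis .
qed

text \<open>The position forces \<open>X [^] i\<close> to be \<open>X [^] k\<close> times a central
  power. By the braid relation \<open>t \<otimes> X [^] k\<close> is
  \<open>X [^] k \<otimes> s\<close>, and \<open>s\<close> is absorbed as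
  \<open>X \<otimes> inv t\<close>.\<close>

lemma t_mult_XT:
  assumes "g \<in> XT" "act (t \<otimes> g) 0 = of_int n * m + m - 1"
  shows "t \<otimes> g \<in> XT"
proof -
  obtain i j :: int where g: "g = X [^] i \<otimes> t [^] j"
    using assms(1) by (auto simp: XT_def)
  have "act t (of_int i * (m - 2)) = act t (of_int n * m + 1)"
    using assms(2) XT_closed[OF assms(1)] by (simp add: act_mult act_t_at) (simp add: g act_XT)
  then have "of_int i * (m - 2) = of_int n * m + 1"
    using strict_mono_eq[OF strict_mono_act_gen[of T_gen]] by simp
  \<comment> \<open>This is the position of 0 under \<open>X [^] k\<close>; subtracting it leaves a
    multiple of \<open>m\<close>.\<close>
  moreover have "real k * (m - 2) = (real k - 1) * m + 1"
    by (simp add: m_def algebra_simps)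
  ultimately have "of_int (i - int k) * (m - 2) = of_int (n - int k + 1) * m"
    by (simp add: algebra_simps)
  then obtain q where q: "i - int k = int (2 * k + 1) * q"
    by (rule multiple_of_m)
  have "X [^] i = X [^] k \<otimes> X [^] (int (2 * k + 1) * q)"
    unfolding q[symmetric] by (simp add: int_pow_int[symmetric] int_pow_mult[symmetric])
  then have "t \<otimes> g = \<Omega> \<otimes> X [^] (int (2 * k + 1) * q) \<otimes> t [^] j"
    by (simp add: g \<Omega>_eq_t m_assoc)
  also have "\<dots> = X [^] k \<otimes> X [^] (int (2 * k + 1) * q) \<otimes> (X \<otimes> inv t) \<otimes> t [^] j"
    unfolding \<Omega>_def s_eq[symmetric] using X_pow_central[of s q] by (simp add: m_assoc)
  also have "X [^] k \<otimes> X [^] (int (2 * k + 1) * q) = X [^] i"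
    unfolding q[symmetric] by (simp add: int_pow_int[symmetric] int_pow_mult[symmetric])
  also have "X [^] i \<otimes> (X \<otimes> inv t) \<otimes> t [^] j \<in> XT"
    by (rule XT_shift)
  finally show ?thesis .
qed

section \<open>Position of 0 under words without a factor \<open>\<Omega>\<close>\<close>

text \<open>
  In both states \<open>l\<close> is the length of the longest alternating prefix of a word for \<open>g\<close>, and \<open>n\<close> is one
  less than its number of blocks of letters \<open>s\<close>.  The clause on equality in the lower bound serves
  to determine the stabiliser of \<open>0\<close>.
\<close>

definition s_state :: "nat \<Rightarrow> int \<Rightarrow> 'a \<Rightarrow> bool" where
  "s_state l n g \<longleftrightarrow> of_int n * m + m - 1 - real l \<le> act g 0 \<and> act g 0 < of_int n * m + m - 1 \<and>
     (act g 0 = of_int n * m + m - 1 - real l \<longrightarrow> g \<in> XT)"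

definition t_state :: "nat \<Rightarrow> int \<Rightarrow> 'a \<Rightarrow> bool" where
  "t_state l n g \<longleftrightarrow> act t (of_int n * m + m - real l) \<le> act g 0 \<and> act g 0 < of_int n * m + m \<and>
     (act g 0 = act t (of_int n * m + m - real l) \<longrightarrow> (\<exists>h\<in>XT. g = t \<otimes> h))"

lemma act_s_less_iff: "act s y < act s z \<longleftrightarrow> y < z" and act_t_less_iff: "act t y < act t z \<longleftrightarrow> y < z"
  using strict_mono_less[OF strict_mono_act_gen[of S_gen]] strict_mono_less[OF strict_mono_act_gen[of T_gen]]
  by simp_all

lemma act_s_le_iff: "act s y \<le> act s z \<longleftrightarrow> y \<le> z" and act_t_le_iff: "act t y \<le> act t z \<longleftrightarrow> y \<le> z"
  using strict_mono_less_eq[OF strict_mono_act_gen[of S_gen]] strict_mono_less_eq[OF strict_mono_act_gen[of T_gen]]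
  by simp_all

lemma act_s_eq_iff: "act s y = act s z \<longleftrightarrow> y = z" and act_t_eq_iff: "act t y = act t z \<longleftrightarrow> y = z"
  using strict_mono_eq[OF strict_mono_act_gen[of S_gen]] strict_mono_eq[OF strict_mono_act_gen[of T_gen]]
  by simp_all

text \<open>As \<open>l\<close> is at most \<open>m - 1\<close>, the point lies in
  \<open>[n m, n m + m - 1)\<close>, and \<open>s\<close> pushes this interval into its last unit.
  The count \<open>l\<close> restarts at 1.\<close>

lemma s_state_s:
  assumes g: "g \<in> carrier G" and l: "real l \<le> m - 1" and "s_state l n g"
  shows "s_state 1 n (s \<otimes> g)"
proof -
  have p: "of_int n * m + m - 1 - real l \<le> act g 0" "act g 0 < of_int n * m + m - 1"
    "act g 0 = of_int n * m + m - 1 - real l \<Longrightarrow> g \<in> XT"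
    using assms(3) by (auto simp: s_state_def)
  have "of_int n * m \<le> act g 0"
    using p(1) l by simp
  then have "act s (of_int n * m) \<le> act s (act g 0)"
    by (simp add: act_s_le_iff)
  moreover have "act s (act g 0) < act s (of_int n * m + m - 1)"
    using p(2) by (simp add: act_s_less_iff)
  \<comment> \<open>Equality needs \<open>l = m - 1\<close> together with equality in the bound for
    \<open>g\<close>.\<close>
  moreover have "s \<otimes> g \<in> XT" if "act s (act g 0) = act s (of_int n * m)"
  proof -
    have "act g 0 = of_int n * m"
      using that by (simp add: act_s_eq_iff)
    then show ?thesis
      using s_mult_XT p l by simp
  qed
  ultimately show ?thesis
    unfolding s_state_def using g by (simp add: act_mult act_s_at act_s_fix)
qed

text \<open>The fixed point \<open>(n + 1) m\<close> of \<open>t\<close> bounds the image from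
  above. The lower bound is kept as an image under \<open>t\<close>, ready for \<open>st\<close> to
  act as a translation in \<open>t_state_s\<close>.\<close>

lemma s_state_t:
  assumes g: "g \<in> carrier G" and "s_state l n g"
  shows "t_state (Suc l) n (t \<otimes> g)"
proof -
  have p: "of_int n * m + m - real (Suc l) \<le> act g 0" "act g 0 < of_int n * m + m - 1"
    "act g 0 = of_int n * m + m - real (Suc l) \<Longrightarrow> g \<in> XT"
    using assms(2) by (auto simp: s_state_def algebra_simps)
  have "act t (act g 0) < act t (of_int (n + 1) * m)"
    using p(2) by (simp add: act_t_less_iff algebra_simps)
  then have "act t (act g 0) < of_int n * m + m"
    unfolding act_t_fix by (simp add: algebra_simps)
  then show ?thesis
    unfolding t_state_def using p g by (auto simp: act_mult act_t_le_iff act_t_eq_iff simp del: of_nat_Suc)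
qed

text \<open>For \<open>l\<close> at most \<open>m - 1\<close> the lower bound is at least the image
  of \<open>n m + 1\<close> under \<open>t\<close>, which is \<open>n m + m - 1\<close>. Equality
  forces equality in the bound for \<open>g\<close>, and then \<open>t_mult_XT\<close>
  applies.\<close>

lemma t_state_t:
  assumes g: "g \<in> carrier G" and l: "real l \<le> m - 1" and "t_state l n g"
  shows "t_state 1 n (t \<otimes> g)"
proof -
  have p: "act t (of_int n * m + m - real l) \<le> act g 0" "act g 0 < of_int n * m + m"
    "act g 0 = act t (of_int n * m + m - real l) \<Longrightarrow> \<exists>h\<in>XT. g = t \<otimes> h"
    using assms(3) by (auto simp: t_state_def)
  have *: "act t (of_int n * m + 1) \<le> act t (of_int n * m + m - real l)"
    using l by (simp add: act_t_le_iff)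
  then have lower: "of_int n * m + m - 1 \<le> act g 0"
    using p(1) unfolding act_t_at by linarith
  have "act t (act g 0) < act t (of_int (n + 1) * m)"
    using p(2) by (simp add: act_t_less_iff algebra_simps)
  then have upper: "act t (act g 0) < of_int n * m + m"
    unfolding act_t_fix by (simp add: algebra_simps)
  have "g \<in> XT" if "act g 0 = of_int n * m + m - 1"
  proof -
    have "act g 0 = act t (of_int n * m + m - real l)"
      using that * p(1) unfolding act_t_at by linarith
    then obtain h where "h \<in> XT" "g = t \<otimes> h"
      using p(3) by blast
    then show ?thesis
      using t_mult_XT that by blast
  qed
  then show ?thesis
    unfolding t_state_def using g lower upper by (auto simp: act_mult act_t_le_iff act_t_eq_iff)
qed

text \<open>Applying \<open>s\<close> to a lower bound that is an image under \<open>t\<close> is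
  the translation by \<open>m - 2\<close>; this gives the new bound with \<open>Suc l\<close> and
  \<open>n + 1\<close>. The upper bound is carried by \<open>s\<close> to
  \<open>(n + 1) m + m - 2\<close>.\<close>

lemma t_state_s:
  assumes g: "g \<in> carrier G" and "t_state l n g"
  shows "s_state (Suc l) (n + 1) (s \<otimes> g)"
proof -
  have p: "act t (of_int n * m + m - real l) \<le> act g 0" "act g 0 < of_int n * m + m"
    "act g 0 = act t (of_int n * m + m - real l) \<Longrightarrow> \<exists>h\<in>XT. g = t \<otimes> h"
    using assms(2) by (auto simp: t_state_def)
  have st: "act s (act t z) = z + (m - 2)" for z
    using act_X[of z] by (simp add: X_def act_mult)
  have "act s (act t (of_int n * m + m - real l)) \<le> act s (act g 0)"
    using p(1) by (simp add: act_s_le_iff)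
  then have lower: "of_int (n + 1) * m + m - 1 - real (Suc l) \<le> act s (act g 0)"
    unfolding st by (simp add: algebra_simps)
  have "act s (act g 0) < act s (of_int (n + 1) * m)"
    using p(2) by (simp add: act_s_less_iff algebra_simps)
  then have upper: "act s (act g 0) < of_int (n + 1) * m + m - 1"
    unfolding act_s_at by simp
  have "s \<otimes> g \<in> XT" if "act s (act g 0) = of_int (n + 1) * m + m - 1 - real (Suc l)"
  proof -
    have "act s (act g 0) = act s (act t (of_int n * m + m - real l))"
      unfolding st that by (simp add: algebra_simps)
    then have "act g 0 = act t (of_int n * m + m - real l)"
      by (simp add: act_s_eq_iff)
    then obtain h where h: "h \<in> XT" "g = t \<otimes> h"
      using p(3) by blast
    then have "s \<otimes> g = X \<otimes> h"
      using XT_closed by (simp add: X_def m_assoc)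
    then show ?thesis
      using X_mult_XT h(1) by simp
  qed
  then show ?thesis
    unfolding s_state_def using g lower upper by (simp add: act_mult del: of_int_add of_nat_Suc)
qed

text \<open>Prepending the first letter again resets the alternating prefix to length 1; prepending
  the other letter lengthens it. Without a factor \<open>\<Omega>\<close> the prefix stays shorter
  than \<open>m\<close>, as \<open>s_state_s\<close> and \<open>t_state_t\<close> require.\<close>

lemma word_state:
  assumes "w \<noteq> []" "last w = S_gen"
    and "\<And>u x y v. x \<noteq> y \<Longrightarrow> w \<noteq> u @ alt_word x y (2 * k + 1) @ v"
  shows "\<exists>l n w'. w = alt_word (hd w) (flip (hd w)) l @ w' \<and> 1 \<le> l \<and> l < 2 * k + 1 \<and>
    (hd w = S_gen \<longrightarrow> blocks w = 2 * n + 1 \<and> s_state l (int n) (val w)) \<and>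
    (hd w = T_gen \<longrightarrow> blocks w = 2 * n + 2 \<and> t_state l (int n) (val w))"
  using assms
proof (induction w)
  case (Cons c w)
  show ?case
  proof (cases "w = []")
    case True
    \<comment> \<open>The single letter \<open>s\<close> attains its lower bound
      \<open>m - 2\<close>, so its membership in \<open>XT\<close> has to be shown.\<close>
    have "s_state 1 0 (s \<otimes> \<one>)"
    proof -
      have "act (s \<otimes> \<one>) 0 = m - 2"
        using act_s_at[of 0] by simp
      moreover have "s \<otimes> \<one> \<in> XT"
        using XT_shift[of 0 0] by (simp add: s_eq[symmetric])
      ultimately show ?thesis
        by (simp add: s_state_def)
    qed
    then show ?thesis
      using True Cons.prems(2) k_pos by - (rule exI[of _ 1], rule exI[of _ 0], rule exI[of _ "[]"], auto)
  next
    case False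
    have free: "w \<noteq> u @ alt_word x y (2 * k + 1) @ v" if "x \<noteq> y" for u x y v
      using Cons.prems(3)[OF that, of "c # u" v] by auto
    then obtain l n w' where IH: "w = alt_word (hd w) (flip (hd w)) l @ w'" "1 \<le> l" "l < 2 * k + 1"
      "hd w = S_gen \<Longrightarrow> blocks w = 2 * n + 1 \<and> s_state l (int n) (val w)"
      "hd w = T_gen \<Longrightarrow> blocks w = 2 * n + 2 \<and> t_state l (int n) (val w)"
      using Cons.IH Cons.prems(2) False by auto
    have l: "real l \<le> m - 1"
      using IH(3) by (simp add: m_def)
    obtain d w0 where w: "w = d # w0"
      using False by (cases w) auto
    show ?thesis
    proof (cases "c = d")
      case True
      then show ?thesis
        using IH(4,5) w s_state_s[OF val_closed l, of "int n" w] t_state_t[OF val_closed l, of "int n" w] k_pos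
        by - (rule exI[of _ 1], rule exI[of _ n], rule exI[of _ w], cases d; simp)
    next
      case neq: False
      then have d: "d = flip c"
        using neq_iff_flip[of d c] by auto
      have cw: "c # w = alt_word c (flip c) (Suc l) @ w'"
        using IH(1) w d by simp
      \<comment> \<open>Otherwise the word would begin with a spelling of
        \<open>\<Omega>\<close>.\<close>
      have "Suc l \<noteq> 2 * k + 1"
        using Cons.prems(3)[of c "flip c" "[]" w'] cw by auto
      then have "Suc l < 2 * k + 1"
        using IH(3) by simp
      moreover have "c # w = alt_word (hd (c # w)) (flip (hd (c # w))) (Suc l) @ w'"
        using cw unfolding list.sel .
      moreover have "blocks (c # w) = 2 * (n + 1) + 1 \<and> s_state (Suc l) (int (n + 1)) (val (c # w))"
        if "c = S_gen"
        using IH(5) w d that t_state_s[OF val_closed, of l "int n" w] by (simp add: add.commute)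
      moreover have "blocks (c # w) = 2 * n + 2 \<and> t_state (Suc l) (int n) (val (c # w))"
        if "c = T_gen"
        using IH(4) w d that s_state_t[OF val_closed, of l "int n" w] by simp
      moreover have "1 \<le> Suc l" "hd (c # w) = c" "S_gen \<noteq> T_gen"
        by simp_all
      ultimately show ?thesis
        by (cases c) metis+
    qed
  qed
qed simp

text \<open>Both states with index \<open>i\<close> lie in \<open>[i m, (i + 1) m)\<close>, whose
  only multiple of \<open>m\<close> is its left end. An \<open>s_state\<close> reaches it only with
  equality in its bound, hence inside \<open>XT\<close>; a \<open>t_state\<close> stays at or beyond
  \<open>i m + m - 1\<close>.\<close>

lemma word_position:
  assumes "w \<noteq> []" "last w = S_gen" "val w \<otimes> inv t \<notin> M"
  defines "n \<equiv> int (Suc (blocks w) div 2)"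
  shows "of_int (n - 1) * m \<le> act (val w) 0" "act (val w) 0 < of_int n * m" "n \<ge> 1"
    "act (val w) 0 = of_int j * m \<Longrightarrow> val w \<in> XT"
proof -
  have "w \<noteq> u @ alt_word x y (2 * k + 1) @ v" if "x \<noteq> y" for u x y v
    using \<Omega>_factor_divisible[OF that] assms(3) by auto
  then obtain l i where st: "1 \<le> l" "l < 2 * k + 1"
    "hd w = S_gen \<Longrightarrow> blocks w = 2 * i + 1 \<and> s_state l (int i) (val w)"
    "hd w = T_gen \<Longrightarrow> blocks w = 2 * i + 2 \<and> t_state l (int i) (val w)"
    using word_state[OF assms(1,2)] by blast
  have l: "real l \<le> m - 1"
    using st(2) by (simp add: m_def)
  have n: "n = int i + 1"
    using st(3,4) by (cases "hd w") (auto simp: n_def)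
  have between: "j = int i" if "real i * m \<le> of_int j * m" "of_int j * m < real i * m + m"
  proof -
    have "real i \<le> of_int j"
      using that(1) m_ge by simp
    moreover have "of_int j * m < (real i + 1) * m"
      using that(2) by (simp add: algebra_simps)
    then have "of_int j < real i + 1"
      using m_ge by simp
    ultimately show ?thesis by linarith
  qed
  have "real i * m \<le> act (val w) 0 \<and> act (val w) 0 < real i * m + m \<and>
    (act (val w) 0 = of_int j * m \<longrightarrow> val w \<in> XT)"
  proof (cases "hd w")
    case S_gen
    then have p: "real i * m + m - 1 - real l \<le> act (val w) 0" "act (val w) 0 < real i * m + m - 1"
      "act (val w) 0 = real i * m + m - 1 - real l \<Longrightarrow> val w \<in> XT"
      using st(3) by (auto simp: s_state_def)
    have "val w \<in> XT" if "act (val w) 0 = of_int j * m"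
    proof -
      have "j = int i"
        by (rule between) (use p l that in linarith)+
      then show ?thesis
        using p(1,3) l that by simp
    qed
    then show ?thesis
      using p l by simp
  next
    case T_gen
    then have p: "act t (real i * m + m - real l) \<le> act (val w) 0" "act (val w) 0 < real i * m + m"
      using st(4) by (auto simp: t_state_def)
    have "act t (of_int (int i) * m + 1) \<le> act t (real i * m + m - real l)"
      using l by (simp add: act_t_le_iff)
    then have lower: "real i * m + m - 1 \<le> act (val w) 0"
      using p(1) unfolding act_t_at by simp
    have "act (val w) 0 \<noteq> of_int j * m"
    proof
      assume *: "act (val w) 0 = of_int j * m"
      have "j = int i"
        by (rule between) (use lower p(2) m_ge * in linarith)+
      then show False
        using lower * m_ge by simp
    qed
    then show ?thesis
      using lower p(2) m_ge by simp
  qed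
  then show "of_int (n - 1) * m \<le> act (val w) 0" "act (val w) 0 < of_int n * m" "n \<ge> 1"
    "act (val w) 0 = of_int j * m \<Longrightarrow> val w \<in> XT"
    by (auto simp: n algebra_simps)
qed

section \<open>Depth as the position of 0\<close>

abbreviation dpt :: "'a \<Rightarrow> nat" where
  "dpt \<equiv> depth G M (submonoid_generate G {t}) (submonoid_generate G {s})"

lemma XT_mult_t_pow:
  assumes "g \<in> XT"
  shows "g \<otimes> t [^] (n::nat) \<in> XT"
proof -
  obtain i j :: int where g: "g = X [^] i \<otimes> t [^] j"
    using assms by (auto simp: XT_def)
  have "t [^] j \<otimes> t [^] n = t [^] (j + int n)"
    by (simp add: int_pow_mult int_pow_int)
  then have "g \<otimes> t [^] n = X [^] i \<otimes> t [^] (j + int n)"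
    by (simp add: g m_assoc)
  then show ?thesis
    unfolding XT_def by blast
qed

text \<open>The final power of \<open>t\<close> fixes 0. The rest is not divisible by
  \<open>t\<close>, so none of its words contains \<open>\<Omega>\<close> and
  \<open>word_position\<close> applies.\<close>

lemma depth_position:
  assumes "a \<in> M"
  shows "dpt a = 0 \<and> act a 0 = 0 \<or>
    dpt a \<ge> 1 \<and> (real (dpt a) - 1) * m \<le> act a 0 \<and> act a 0 < real (dpt a) * m" (is ?pos)
    and "act a 0 = of_int j * m \<Longrightarrow> a \<in> XT"
proof -
  obtain w e where w: "a = val w \<otimes> t [^] (e::nat)" "val w \<otimes> inv t \<notin> M" "w \<noteq> [] \<Longrightarrow> last w = S_gen"
    "dpt a = Suc (blocks w) div 2"
    using depth_word[OF assms] by metis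
  have act: "act a 0 = act (val w) 0"
    using act_t_int_pow_0[of "int e"] by (simp add: w(1) act_mult int_pow_int)
  have "?pos \<and> (act a 0 = of_int j * m \<longrightarrow> a \<in> XT)"
  proof (cases "w = []")
    case True
    have "a \<in> XT"
      using XT_mult_t_pow[OF t_pow_XT[of 0], of e] by (simp add: w(1) True)
    then show ?thesis
      using True w(4) act by simp
  next
    case False
    note pos = word_position[OF False w(3)[OF False] w(2)]
    have "a \<in> XT" if "act a 0 = of_int j * m"
      unfolding w(1) using pos(4)[of j] act that by (intro XT_mult_t_pow) simp
    then show ?thesis
      using pos(1,2,3) unfolding act w(4)[symmetric] by simp
  qed
  then show ?pos "act a 0 = of_int j * m \<Longrightarrow> a \<in> XT"
    by blast+
qed

section \<open>Fractions and \<open>\<Delta>\<close>-forms\<close>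

lemma M_pow: "a \<in> M \<Longrightarrow> a [^] (n::nat) \<in> M"
  by (induction n) (auto intro: M_mult)

lemma X_M: "X \<in> M"
  using val_M[of "[S_gen, T_gen]"] by (simp add: X_def)

lemma \<Omega>_M: "\<Omega> \<in> M"
  using val_M[of "alt_word S_gen T_gen (2 * k + 1)"] unfolding val_alt_word[OF artin_gen.distinct(1)] .

lemma \<Delta>_M: "\<Delta> \<in> M"
  unfolding \<Delta>_def by (rule M_mult[OF \<Omega>_M \<Omega>_M])

lemma len_\<Delta>: "len \<Delta> > 0"
proof -
  have "len \<Omega> = len (X [^] k) + 1"
    using len_gen[of S_gen] by (simp add: \<Omega>_def len_mult)
  then have "len \<Omega> > 0"
    using len_M_nonneg[OF M_pow[OF X_M, of k]] by simp
  then show ?thesis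
    by (simp add: \<Delta>_def len_mult)
qed

lemma \<Delta>_mult_inv_gen: "\<Delta> \<otimes> inv (gen x) \<in> M"
proof -
  have "\<Omega> \<otimes> inv (gen x) \<in> M"
  proof (cases x)
    case S_gen
    then show ?thesis
      using M_pow[OF X_M, of k] by (simp add: \<Omega>_def m_assoc)
  next
    case T_gen
    then show ?thesis
      using \<Omega>_factor_divisible[OF artin_gen.distinct(1), of "[]" "[]"] val_alt_word[OF artin_gen.distinct(1)]
      by (simp only: append_Nil append_Nil2 gen_simps)
  qed
  then show ?thesis
    using M_mult[OF \<Omega>_M] by (simp add: \<Delta>_def m_assoc)
qed

lemma \<Delta>_pow_commute: "a \<in> carrier G \<Longrightarrow> \<Delta> [^] (i::int) \<otimes> a = a \<otimes> \<Delta> [^] i"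
  by (rule int_pow_commute) (simp_all add: \<Delta>_central)

text \<open>Each generator divides the central element \<open>\<Delta>\<close>, so its inverse
  becomes an element of \<open>M\<close> after multiplication by \<open>\<Delta>\<close>.\<close>

lemma fraction_exists:
  assumes "a \<in> carrier G"
  shows "\<exists>b\<in>M. \<exists>j::int. a = b \<otimes> \<Delta> [^] j"
proof -
  have "a \<in> generate G {s, t}"
    using assms generated by simp
  then show ?thesis
  proof induction
    case one
    show ?case
      by (rule bexI[of _ \<one>], rule exI[of _ 0]) auto
  next
    case (incl h)
    then have "h \<in> M" using gen_pow_M[of S_gen 1] gen_pow_M[of T_gen 1] by auto
    then show ?case
      by (intro bexI[of _ h] exI[of _ 0]) (simp_all add: M_closed)
  next
    case (inv h)
    then obtain x where x: "h = gen x"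
      by (metis gen_simps insertE singletonD)
    have "inv h = \<Delta> \<otimes> inv h \<otimes> \<Delta> [^] (-1 :: int)"
      unfolding x \<Delta>_central[OF inv_closed[OF gen_closed], symmetric] by (simp add: m_assoc int_pow_neg)
    then show ?case
      using \<Delta>_mult_inv_gen[of x] unfolding x by blast
  next
    case (eng h1 h2)
    then obtain b1 b2 and i1 i2 :: int where b: "b1 \<in> M" "h1 = b1 \<otimes> \<Delta> [^] i1" "b2 \<in> M" "h2 = b2 \<otimes> \<Delta> [^] i2"
      by blast
    have "h1 \<otimes> h2 = b1 \<otimes> (\<Delta> [^] i1 \<otimes> b2) \<otimes> \<Delta> [^] i2"
      using b M_closed by (simp add: m_assoc)
    also have "\<dots> = (b1 \<otimes> b2) \<otimes> \<Delta> [^] (i1 + i2)"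
      unfolding \<Delta>_pow_commute[OF M_closed[OF b(3)]] using b M_closed by (simp add: m_assoc int_pow_mult)
    finally show ?case
      using M_mult[OF b(1,3)] by blast
  qed
qed

text \<open>Splitting off a factor \<open>\<Delta>\<close> lowers the degree, which is nonnegative
  on \<open>M\<close>, so the process ends.\<close>

lemma delta_form_exists:
  assumes "a \<in> carrier G"
  shows "\<exists>b j. is_delta_form G M \<Delta> a b j"
proof -
  obtain b and j :: int where b: "b \<in> M" "a = b \<otimes> \<Delta> [^] j"
    using fraction_exists[OF assms] by blast
  then show ?thesis
  proof (induction "nat (len b)" arbitrary: b j rule: less_induct)
    case less
    show ?case
    proof (cases "le_R G M \<Delta> b")
      case False
      then show ?thesis
        unfolding is_delta_form_def unmovable_def using less.prems by blast
    next
      case True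
      then have c: "b \<otimes> inv \<Delta> \<in> M"
        by (simp add: le_R_def)
      have "b \<in> carrier G"
        using less.prems M_closed by simp
      then have "len (b \<otimes> inv \<Delta>) = len b - len \<Delta>"
        by (simp add: len_mult len_inv)
      then have "nat (len (b \<otimes> inv \<Delta>)) < nat (len b)"
        using len_M_nonneg[OF c] len_\<Delta> by simp
      moreover have "a = b \<otimes> inv \<Delta> \<otimes> \<Delta> [^] (1 + j)"
        using \<open>b \<in> carrier G\<close> less.prems(2) by (simp add: int_pow_mult m_assoc) (simp add: m_assoc[symmetric])
      ultimately show ?thesis
        using less.hyps c by blast
    qed
  qed
qed

section \<open>Stabiliser of 0 and signs\<close>

lemma act_mult_\<Delta>_pow:
  assumes "b \<in> carrier G"
  shows "act (b \<otimes> \<Delta> [^] (j::int)) z = act b z + of_int j * (m - 2) * m"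
  unfolding \<Delta>_pow_commute[OF assms, symmetric] using assms by (simp add: act_mult act_\<Delta>_int_pow)

lemma strict_mono_act:
  assumes "a \<in> carrier G"
  shows "strict_mono (act a)"
proof -
  obtain w and j :: int where a: "a = val w \<otimes> \<Delta> [^] j"
    using fraction_exists[OF assms] by (auto simp: M_eq)
  have "strict_mono (act (val w))"
  proof (induction w)
    case (Cons x w)
    then show ?case
      using strict_mono_act_gen[of x] by (simp add: strict_mono_def act_mult)
  qed (simp add: strict_mono_def)
  then show ?thesis
    by (simp add: a act_mult_\<Delta>_pow strict_mono_def)
qed

text \<open>The numerator \<open>b\<close> moves 0 to a multiple of \<open>m\<close>, so it lies in
  \<open>XT\<close>. Comparing positions shows that its power of \<open>X\<close> cancels the power
  of \<open>\<Delta>\<close>, leaving a power of \<open>t\<close>.\<close>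

lemma stabilizer_of_0:
  assumes "a \<in> carrier G" "act a 0 = 0"
  shows "a \<in> generate G {t}"
proof -
  obtain b and j :: int where b: "b \<in> M" "a = b \<otimes> \<Delta> [^] j"
    using fraction_exists[OF assms(1)] by blast
  have act: "act b 0 = - (of_int j * (m - 2) * m)"
    using assms(2) b M_closed by (simp add: act_mult_\<Delta>_pow)
  \<comment> \<open>Since \<open>m - 2\<close> is the integer \<open>2 k - 1\<close>, the position
    is an integer multiple of \<open>m\<close>.\<close>
  also have "\<dots> = of_int (- j * (2 * int k - 1)) * m"
    by (simp add: m_def algebra_simps)
  finally have "b \<in> XT"
    by (rule depth_position(2)[OF b(1)])
  then obtain p q :: int where pq: "b = X [^] p \<otimes> t [^] q"
    by (auto simp: XT_def)
  have "of_int p * (m - 2) = - (of_int j * m) * (m - 2)"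
    using act unfolding pq act_XT by (simp add: algebra_simps)
  then have "real_of_int p = - (of_int j * m)"
    using m_ge by (simp only: mult_cancel_right) simp
  also have "\<dots> = real_of_int (int (2 * k + 1) * - j)"
    by (simp add: m_def)
  finally have "p = int (2 * k + 1) * - j"
    by (simp only: of_int_eq_iff)
  then have X: "X [^] p = \<Delta> [^] (- j)"
    unfolding \<Delta>_eq by (metis X_closed int_pow_int int_pow_pow)
  have "a = \<Delta> [^] (- j) \<otimes> (t [^] q \<otimes> \<Delta> [^] j)"
    by (simp add: b(2) pq X m_assoc)
  also have "t [^] q \<otimes> \<Delta> [^] j = \<Delta> [^] j \<otimes> t [^] q"
    by (simp add: \<Delta>_pow_commute)
  also have "\<Delta> [^] (- j) \<otimes> (\<Delta> [^] j \<otimes> t [^] q) = t [^] q"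
    by (simp add: m_assoc[symmetric] int_pow_neg)
  finally have "a = t [^] q" .
  then show ?thesis
    by (auto simp: generate_pow)
qed

text \<open>The image of 0 is \<open>c m\<close>, the left end of the interval
  \<open>[c m, (c + 1) m)\<close> that belongs to depth \<open>c + 1\<close>.\<close>

lemma depth_\<Delta>_pow:
  assumes "j \<ge> 1"
  shows "real (dpt (\<Delta> [^] (j::int))) = of_int j * (m - 2) + 1"
proof -
  define c where "c = j * (2 * int k - 1)"
  have c: "of_int j * (m - 2) = real_of_int c"
    by (simp add: m_def c_def)
  have "\<Delta> [^] j \<in> M"
    using M_pow[OF \<Delta>_M, of "nat j"] int_pow_int[where x = \<Delta> and n = "nat j"] assms by simp
  note pos = depth_position(1)[OF this]
  have act: "act (\<Delta> [^] j) 0 = real_of_int c * m"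
    unfolding act_\<Delta>_int_pow c by simp
  moreover have "c > 0"
    using assms k_pos by (simp add: c_def)
  ultimately have "(real (dpt (\<Delta> [^] j)) - 1) * m \<le> real_of_int c * m"
    "real_of_int c * m < real (dpt (\<Delta> [^] j)) * m"
    using pos m_ge by auto
  then have "real_of_int (int (dpt (\<Delta> [^] j)) - 1) \<le> real_of_int c"
    "real_of_int c < real_of_int (int (dpt (\<Delta> [^] j)))"
    using m_ge by simp_all
  then have "int (dpt (\<Delta> [^] j)) = c + 1"
    unfolding of_int_less_iff of_int_le_iff by simp
  then show ?thesis
    unfolding c by (metis of_int_1 of_int_add of_int_of_nat_eq)
qed

text \<open>For \<open>b \<otimes> \<Delta> [^] (- j)\<close> a negative position means
  \<open>act b 0 < c m\<close> with \<open>c = j (m - 2)\<close>. As the depth intervals end at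
  multiples of \<open>m\<close>, this says that the depth of \<open>b\<close> is at most
  \<open>c\<close>, one less than that of \<open>\<Delta> [^] j\<close>.\<close>

lemma dehornoy_negative_iff:
  assumes "a \<in> carrier G"
  shows "dehornoy_negative G M \<Delta> (submonoid_generate G {s}) (submonoid_generate G {t}) a \<longleftrightarrow> act a 0 < 0"
proof
  assume "dehornoy_negative G M \<Delta> (submonoid_generate G {s}) (submonoid_generate G {t}) a"
  then obtain b and j :: int where b: "b \<in> M" "a = b \<otimes> \<Delta> [^] (- j)" "j \<ge> 1" "dpt b < dpt (\<Delta> [^] j)"
    by (auto simp: dehornoy_negative_def is_delta_form_def unmovable_def)
  define c where "c = j * (2 * int k - 1)"
  have c: "of_int j * (m - 2) = real_of_int c"
    by (simp add: m_def c_def)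
  have "real (dpt b) < real_of_int c + 1"
    using b(4) depth_\<Delta>_pow[OF b(3)] unfolding c by simp
  then have "real_of_int (int (dpt b)) < real_of_int (c + 1)"
    by simp
  then have "int (dpt b) \<le> c"
    unfolding of_int_less_iff by simp
  then have "real (dpt b) \<le> real_of_int c"
    by (metis of_int_le_iff of_int_of_nat_eq)
  then have "real (dpt b) * m \<le> real_of_int c * m"
    using m_ge by (intro mult_right_mono) auto
  moreover have "real_of_int c * m > 0"
  proof -
    have "c > 0" using b(3) k_pos by (simp add: c_def)
    then show ?thesis using m_ge by simp
  qed
  ultimately have "act b 0 < real_of_int c * m"
    using depth_position(1)[OF b(1)] by linarith
  moreover have "act a 0 = act b 0 - real_of_int c * m"
    unfolding b(2) act_mult_\<Delta>_pow[OF M_closed[OF b(1)]] c[symmetric] by simp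
  ultimately show "act a 0 < 0"
    by simp
next
  assume neg: "act a 0 < 0"
  obtain b i where f: "is_delta_form G M \<Delta> a b i"
    using delta_form_exists[OF assms] by blast
  then have b: "b \<in> M" "a = b \<otimes> \<Delta> [^] i"
    by (auto simp: is_delta_form_def unmovable_def)
  have lt: "act b 0 < of_int (- i) * (m - 2) * m"
    using neg unfolding b(2) act_mult_\<Delta>_pow[OF M_closed[OF b(1)]] by simp
  \<comment> \<open>Elements of \<open>M\<close> never move 0 to the left, so a negative position
    forces a negative exponent of \<open>\<Delta>\<close>.\<close>
  have "act b 0 \<ge> 0"
  proof -
    have "(real (dpt b) - 1) * m \<ge> 0" if "dpt b \<ge> 1"
      using that m_ge by simp
    then show ?thesis
      using depth_position(1)[OF b(1)] by linarith
  qed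
  then have "0 < of_int (- i) * (m - 2) * m"
    using lt by linarith
  then have "- i \<ge> 1"
    using m_ge by (simp add: zero_less_mult_iff mult_less_0_iff)
  moreover have "dpt b < dpt (\<Delta> [^] (- i))"
  proof -
    have "real (dpt b) < of_int (- i) * (m - 2) + 1"
    proof (cases "dpt b \<ge> 1")
      case True
      then have "(real (dpt b) - 1) * m < of_int (- i) * (m - 2) * m"
        using depth_position(1)[OF b(1)] lt by linarith
      then have "real (dpt b) - 1 < of_int (- i) * (m - 2)"
        by (rule mult_right_less_imp_less) (use m_ge in simp)
      then show ?thesis
        by linarith
    next
      case False
      have "0 \<le> of_int (- i) * (m - 2)"
        using \<open>- i \<ge> 1\<close> m_ge by (intro mult_nonneg_nonneg) auto
      then show ?thesis
        using False by simp
    qed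
    then show ?thesis
      using depth_\<Delta>_pow[OF \<open>- i \<ge> 1\<close>] by simp
  qed
  ultimately show "dehornoy_negative G M \<Delta> (submonoid_generate G {s}) (submonoid_generate G {t}) a"
    unfolding dehornoy_negative_def using f by (intro exI[of _ b] exI[of _ "- i"]) simp
qed

text \<open>Positive elements, negative elements and \<open>generate G {t}\<close> move 0 to the
  right, to the left and not at all. The partition is trichotomy on the line, and closure holds
  because every element acts increasingly.\<close>

theorem dehornoy_structure_t:
  "dehornoy_structure G M \<Delta> (H, submonoid_generate G {s}) (generate G {t}, submonoid_generate G {t})"
proof -
  let ?P = "positive_elements G M \<Delta> (submonoid_generate G {s}) (submonoid_generate G {t})"
  have inv_act: "act (inv a) 0 < 0 \<longleftrightarrow> 0 < act a 0" "0 < act (inv a) 0 \<longleftrightarrow> act a 0 < 0" if "a \<in> carrier G" for a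
    using strict_mono_less[OF strict_mono_act[OF that], of "act (inv a) 0" 0]
      strict_mono_less[OF strict_mono_act[OF that], of 0 "act (inv a) 0"] that by simp_all
  have P: "?P = {a \<in> carrier G. 0 < act a 0}"
    by (auto simp: positive_elements_def dehornoy_negative_iff inv_act)
  have P_inv: "set_inv ?P = {a \<in> carrier G. act a 0 < 0}"
  proof
    show "set_inv ?P \<subseteq> {a \<in> carrier G. act a 0 < 0}"
      by (auto simp: P SET_INV_def inv_act)
    show "{a \<in> carrier G. act a 0 < 0} \<subseteq> set_inv ?P"
    proof
      fix a assume "a \<in> {a \<in> carrier G. act a 0 < 0}"
      then have "inv a \<in> ?P" "a = inv (inv a)"
        by (simp_all add: P inv_act)
      then show "a \<in> set_inv ?P"
        unfolding SET_INV_def by blast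
    qed
  qed
  have G1: "generate G {t} = {a \<in> carrier G. act a 0 = 0}"
    using stabilizer_of_0 by (auto simp: generate_pow act_t_int_pow_0)
  \<comment> \<open>The weak inequality for \<open>a\<close> covers left factors from both
    \<open>P\<close> and \<open>G1\<close>; a right factor from \<open>G1\<close> does not change
    the image of 0.\<close>
  have "0 < act (a \<otimes> b) 0" if "a \<in> carrier G" "b \<in> carrier G" "0 \<le> act a 0" "0 < act b 0" for a b
    using strict_mono_less[OF strict_mono_act[OF that(1)], of 0 "act b 0"] that by (simp add: act_mult)
  moreover have "act (a \<otimes> b) 0 = act a 0" if "a \<in> carrier G" "b \<in> carrier G" "act b 0 = 0" for a b
    using that by (simp add: act_mult)
  ultimately show ?thesis
    unfolding dehornoy_structure_def Let_def prod.case P_inv G1 unfolding P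
    by (auto simp: set_mult_def)
qed

end

section \<open>Specialisation to the Artin group\<close>

theorem corollary6p2:
  fixes k m :: nat
    and G :: "artin_gen gword set monoid"
    and s t \<Omega> \<Delta> :: "artin_gen gword set"
    and M G1 M1 H N :: "artin_gen gword set set"
  assumes "m = 2 * k + 1" and "m \<ge> 5"
    and "G = artin_I2 m" and "s = artin_s m" and "t = artin_t m"
    and "M = submonoid_generate G {s, t}"
    and "\<Omega> = list_prod G (alt_word s t m)"
    and "\<Delta> = \<Omega> [^]\<^bsub>G\<^esub> (2::nat)"
    and "G1 = generate G {t}" and "M1 = submonoid_generate G {t}"
    and "H = generate G {s}" and "N = submonoid_generate G {s}"
  shows "dehornoy_structure G M \<Delta> (H, N) (G1, M1)"
proof -
  have k: "k \<ge> 1"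
    using assms(1,2) by simp
  interpret group G
    unfolding assms(3) by (rule group_artin_I2)
  have st: "s \<in> carrier G" "t \<in> carrier G"
    unfolding assms(3-5) by (rule artin_s_carrier artin_t_carrier)+
  obtain len where len: "len \<in> hom G integer_group" "len s = 1" "len t = 1"
    by (rule artin_I2_len_exists[of m, folded assms(3-5)])
  obtain act where act:
    "\<forall>a\<in>carrier G. \<forall>b\<in>carrier G. \<forall>z. act (a \<otimes>\<^bsub>G\<^esub> b) z = act a (act b z)"
    "act s = shear (real m)" "act t = (\<lambda>z. shear (real m) (z - 1) + 1)"
    using artin_I2_act_exists[OF k, folded assms(1), folded assms(3-5)] by blast
  have odd: "list_prod G (alt_word s t m) = (s \<otimes>\<^bsub>G\<^esub> t) [^]\<^bsub>G\<^esub> k \<otimes>\<^bsub>G\<^esub> s"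
    "list_prod G (alt_word t s m) = (t \<otimes>\<^bsub>G\<^esub> s) [^]\<^bsub>G\<^esub> k \<otimes>\<^bsub>G\<^esub> t"
    unfolding assms(1) by (rule list_prod_alt_word_odd[OF st(1,2)], rule list_prod_alt_word_odd[OF st(2,1)])
  have braid: "(s \<otimes>\<^bsub>G\<^esub> t) [^]\<^bsub>G\<^esub> k \<otimes>\<^bsub>G\<^esub> s = (t \<otimes>\<^bsub>G\<^esub> s) [^]\<^bsub>G\<^esub> k \<otimes>\<^bsub>G\<^esub> t"
    unfolding odd[symmetric] unfolding assms(3-5) by (rule artin_I2_relation)
  have gen: "carrier G = generate G {s, t}"
    unfolding assms(3-5) by (rule artin_I2_generated)
  interpret I2: dihedral_artin_action G s t len k act
    by unfold_locales (use st len k gen braid act assms(1) in auto)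
  have "\<Delta> = I2.\<Delta>"
    unfolding assms(7,8) odd I2.\<Delta>_def I2.\<Omega>_def I2.X_def using st by (simp add: numeral_2_eq_2)
  then show ?thesis
    using I2.dehornoy_structure_t[of H] by (simp add: assms(6,9,10,12))
qed

end
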